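(* Assume that the arrival processes are Poisson with rates $\lambda_i^n$, $i\in\mathcal{I}$, and let $n\in\mathbb{N}$ be such that $\varrho^n>0$. Then for some $\theta=\theta(n)>0$ there exist positive constants $\hat\varepsilon_0(n)$ and $C_0^n(\varepsilon)$ such that the function $$V(\hat x)=\exp\Bigl(\sum_{i\in\mathcal{I}}\frac{\varepsilon\theta\psi(-\hat x_i)+\psi_\varepsilon(\hat x_i)}{\mu_i^n}\Bigr)$$ satisfies $$\widehat{\mathscr{A}}^n_zV(\hat x)\le C_0^n(\varepsilon)-\varepsilon\frac{\varrho^n}{2m}V(\hat x)\qquad\forall\,\hat x\in\mathscr{X}^n,\ \forall\,z\in\mathcal{Z}^n(\hat x),$$ for all $\varepsilon\in(0,\hat\varepsilon_0(n))$. In particular, under any work-conserving stationary Markov policy, the process $\{\hat X^n(t)\}_{t\ge0}$ is exponentially ergodic, and $V(\hat x)$ is integrable under its invariant probability measure.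
   Context: Model. $\mathcal{I}=\{1,\dots,m\}$ customer classes, $n$ servers; $e_i$ is the $i$-th unit vector, $a\wedge b=\min(a,b)$, $\|x\|_1=\sum_i|x_i|$. Class-$i$ customers arrive according to a Poisson process of rate $\lambda_i^n$; service and patience times are exponential with rates $\mu_i^n>0$, $\gamma_i^n\ge0$; all mutually independent. As $n\to\infty$: $\lambda_i^n/n\to\lambda_i>0$, $\mu_i^n\to\mu_i>0$, $\gamma_i^n\to\gamma_i\ge0$, $(\lambda_i^n-n\lambda_i)/\sqrt n$ and $\sqrt n(\mu_i^n-\mu_i)$ converge, $\lambda_i^n/(n\mu_i^n)\to\rho_i=\lambda_i/\mu_i<1$, $\sum_i\rho_i=1$. Put $\varrho^n=\sqrt n\,(1-\sum_i\lambda_i^n/(n\mu_i^n))$. State. $X_i^n(t)$ is the number of class-$i$ customers in system, $Z_i^n(t)$ the number in service. Scheduling is preemptive; $\mathcal{Z}^n(x)=\{z\in\mathbb{Z}_+^m: z_i\le x_i,\ \|z\|_1=n\wedge\|x\|_1\}$ (work conservation). A work-conserving stationary Markov policy is $Z^n(t)=z(X^n(t))$ with $z(x)\in\mathcal{Z}^n(x)$. With $q_i(x,z)=x_i-z_i$, under such a policy $X^n$ is Markov with extended generator $$\mathscr{A}^n_zf(x)=\sum_i\lambda_i^n\bigl(f(x+e_i)-f(x)\bigr)+\sum_i\bigl(\mu_i^nz_i+\gamma_i^nq_i(x,z)\bigr)\bigl(f(x-e_i)-f(x)\bigr).$$ Scaling: $\hat x_i=\hat x_i^n(x)=\frac1{\sqrt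 n}(x_i-\frac{\lambda_i^n}{\mu_i^n})-\frac{\varrho^n}{m}$, $\hat X^n(t)=\hat x^n(X^n(t))$; $\mathscr{X}^n=\hat x^n(\mathbb{Z}_+^m)$; $\mathcal{Z}^n(\hat x)$ denotes $\mathcal{Z}^n(x)$ for $\hat x=\hat x^n(x)$; $\widehat{\mathscr{A}}^n_zf(\hat x^n(x))=\mathscr{A}^n_z[f\circ\hat x^n](x)$. Functions. $\psi(t)=-\frac12$ for $t\le-1$, $\psi(t)=(t+1)^3-\frac12(t+1)^4-\frac12$ on $[-1,0]$, $\psi(t)=t$ for $t\ge0$; $\psi_\varepsilon(t)=\psi(\varepsilon t)$. *)

theory Defs
  imports "HOL-Probability.Probability"
begin

section \<open>Markov processes on a countable state space\<close>

text \<open>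
  A process is a family of laws \<open>P x\<close>, indexed by the initial state \<open>x \<in> S\<close>, together with random
  variables \<open>X t\<close>, \<open>t \<ge> 0\<close>, with values in the countable set \<open>S\<close> with its discrete \<open>\<sigma>\<close>-algebra.
  It has infinite lifetime, and its paths are right-continuous with left limits in the discrete
  topology.
\<close>

definition past_events :: "'s set \<Rightarrow> 'w measure \<Rightarrow> (real \<Rightarrow> 'w \<Rightarrow> 's) \<Rightarrow> real \<Rightarrow> 'w set set" where
  "past_events S M X s =
     sigma_sets (space M) {X u -` B \<inter> space M | u B. 0 \<le> u \<and> u \<le> s \<and> B \<subseteq> S}"

definition markov_process ::
  "'s set \<Rightarrow> ('s \<Rightarrow> 'w measure) \<Rightarrow> (real \<Rightarrow> 'w \<Rightarrow> 's) \<Rightarrow> bool" where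
  "markov_process S P X \<longleftrightarrow>
     countable S \<and>
     (\<forall>x\<in>S. prob_space (P x)
        \<and> (\<forall>t\<ge>0. X t \<in> measurable (P x) (count_space S))
        \<and> (AE \<omega> in P x. X 0 \<omega> = x)
        \<and> (AE \<omega> in P x. (\<forall>t\<ge>0. \<forall>\<^sub>F u in at_right t. X u \<omega> = X t \<omega>)
             \<and> (\<forall>t>0. \<exists>y\<in>S. \<forall>\<^sub>F u in at_left t. X u \<omega> = y))
        \<and> (\<forall>s\<ge>0. \<forall>t\<ge>0. \<forall>A \<in> past_events S (P x) X s. \<forall>y\<in>S.
             measure (P x) (A \<inter> (X (s + t) -` {y} \<inter> space (P x))) =
             (LINT \<omega>:A|P x. measure (P (X s \<omega>)) (X t -` {y} \<inter> space (P (X s \<omega>))))))"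

text \<open>
  The pair \<open>(f, g)\<close> belongs to the extended generator in the sense of Meyn and Tweedie:
  \<open>E\<^sub>x f(X\<^sub>t) = f(x) + \<integral>\<^sub>0\<^sup>t E\<^sub>x g(X\<^sub>s) ds\<close>, with \<open>\<integral>\<^sub>0\<^sup>t E\<^sub>x \<bar>g(X\<^sub>s)\<bar> ds < \<infinity>\<close>.
\<close>

definition in_extended_generator ::
  "'s set \<Rightarrow> ('s \<Rightarrow> 'w measure) \<Rightarrow> (real \<Rightarrow> 'w \<Rightarrow> 's) \<Rightarrow> ('s \<Rightarrow> real) \<Rightarrow> ('s \<Rightarrow> real) \<Rightarrow> bool" where
  "in_extended_generator S P X f g \<longleftrightarrow>
     (\<forall>x\<in>S. \<forall>t\<ge>0.
        integrable (P x) (\<lambda>\<omega>. f (X t \<omega>)) \<and>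
        integrable (P x) (\<lambda>\<omega>. g (X t \<omega>)) \<and>
        set_integrable lborel {0..t} (\<lambda>s. LINT \<omega>|P x. \<bar>g (X s \<omega>)\<bar>) \<and>
        (LINT \<omega>|P x. f (X t \<omega>)) = f x + (LINT s:{0..t}|lborel. (LINT \<omega>|P x. g (X s \<omega>))))"

text \<open>
  The operator \<open>A\<close> is required to act as the extended generator on the finitely supported
  functions only; for a process with infinite lifetime on a discrete space this is the usual core
  of test functions.
\<close>

definition has_generator ::
  "'s set \<Rightarrow> ('s \<Rightarrow> 'w measure) \<Rightarrow> (real \<Rightarrow> 'w \<Rightarrow> 's) \<Rightarrow> (('s \<Rightarrow> real) \<Rightarrow> 's \<Rightarrow> real) \<Rightarrow> bool" where
  "has_generator S P X A \<longleftrightarrow>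
     (\<forall>f. finite {y. f y \<noteq> 0} \<longrightarrow> in_extended_generator S P X f (A f))"

definition invariant_probability ::
  "'s set \<Rightarrow> ('s \<Rightarrow> 'w measure) \<Rightarrow> (real \<Rightarrow> 'w \<Rightarrow> 's) \<Rightarrow> 's measure \<Rightarrow> bool" where
  "invariant_probability S P X \<pi> \<longleftrightarrow>
     prob_space \<pi> \<and> sets \<pi> = sets (count_space S) \<and>
     (\<forall>t\<ge>0. \<forall>B\<subseteq>S. measure \<pi> B = (LINT x|\<pi>. measure (P x) (X t -` B \<inter> space (P x))))"

definition tv_dist :: "'s measure \<Rightarrow> 's measure \<Rightarrow> real" where
  "tv_dist \<mu> \<nu> = (SUP B\<in>sets \<mu>. \<bar>measure \<mu> B - measure \<nu> B\<bar>)"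

definition exponentially_ergodic ::
  "'s set \<Rightarrow> ('s \<Rightarrow> 'w measure) \<Rightarrow> (real \<Rightarrow> 'w \<Rightarrow> 's) \<Rightarrow> bool" where
  "exponentially_ergodic S P X \<longleftrightarrow>
     (\<exists>\<pi> \<kappa>. invariant_probability S P X \<pi> \<and> 0 < \<kappa> \<and>
        (\<forall>x\<in>S. \<exists>M. \<forall>t\<ge>0.
           tv_dist (distr (P x) (count_space S) (X t)) \<pi> \<le> M * exp (- \<kappa> * t)))"

section \<open>The multiclass many-server queue\<close>

text \<open>
  The classes are the elements of a finite type \<open>'m\<close>, so \<open>m = CARD('m)\<close>; \<open>lam n i\<close>, \<open>mu n i\<close>,
  \<open>gam n i\<close> are the rates of class \<open>i\<close> in the system with \<open>n\<close> servers.
\<close>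

definition spare_capacity ::
  "(nat \<Rightarrow> 'm::finite \<Rightarrow> real) \<Rightarrow> (nat \<Rightarrow> 'm \<Rightarrow> real) \<Rightarrow> nat \<Rightarrow> real" where
  "spare_capacity lam mu n = sqrt (real n) * (1 - (\<Sum>i\<in>UNIV. lam n i / (real n * mu n i)))"

definition work_conserving :: "nat \<Rightarrow> nat ^ 'm::finite \<Rightarrow> (nat ^ 'm) set" where
  "work_conserving n x =
     {z. (\<forall>i. z $ i \<le> x $ i) \<and> (\<Sum>i\<in>UNIV. z $ i) = min n (\<Sum>i\<in>UNIV. x $ i)}"

text \<open>
  The subtraction \<open>x - axis i 1\<close> truncates at \<open>x $ i = 0\<close>, but there \<open>z $ i = 0\<close> as well for every
  work-conserving \<open>z\<close>, so that this term has rate \<open>0\<close>.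
\<close>

definition queue_generator ::
  "(nat \<Rightarrow> 'm::finite \<Rightarrow> real) \<Rightarrow> (nat \<Rightarrow> 'm \<Rightarrow> real) \<Rightarrow> (nat \<Rightarrow> 'm \<Rightarrow> real) \<Rightarrow> nat \<Rightarrow>
   nat ^ 'm \<Rightarrow> (nat ^ 'm \<Rightarrow> real) \<Rightarrow> nat ^ 'm \<Rightarrow> real" where
  "queue_generator lam mu gam n z f x =
     (\<Sum>i\<in>UNIV. lam n i * (f (x + axis i 1) - f x)) +
     (\<Sum>i\<in>UNIV. (mu n i * real (z $ i) + gam n i * (real (x $ i) - real (z $ i)))
                 * (f (x - axis i 1) - f x))"

definition stationary_policy :: "nat \<Rightarrow> (nat ^ 'm::finite \<Rightarrow> nat ^ 'm) \<Rightarrow> bool" where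
  "stationary_policy n \<zeta> \<longleftrightarrow> (\<forall>x. \<zeta> x \<in> work_conserving n x)"

definition queue_process ::
  "(nat \<Rightarrow> 'm::finite \<Rightarrow> real) \<Rightarrow> (nat \<Rightarrow> 'm \<Rightarrow> real) \<Rightarrow> (nat \<Rightarrow> 'm \<Rightarrow> real) \<Rightarrow> nat \<Rightarrow>
   (nat ^ 'm \<Rightarrow> nat ^ 'm) \<Rightarrow> (nat ^ 'm \<Rightarrow> 'w measure) \<Rightarrow> (real \<Rightarrow> 'w \<Rightarrow> nat ^ 'm) \<Rightarrow> bool" where
  "queue_process lam mu gam n \<zeta> P X \<longleftrightarrow>
     markov_process UNIV P X \<and>
     has_generator UNIV P X (\<lambda>f x. queue_generator lam mu gam n (\<zeta> x) f x)"

definition scaled ::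
  "(nat \<Rightarrow> 'm::finite \<Rightarrow> real) \<Rightarrow> (nat \<Rightarrow> 'm \<Rightarrow> real) \<Rightarrow> nat \<Rightarrow> nat ^ 'm \<Rightarrow> real ^ 'm" where
  "scaled lam mu n x =
     (\<chi> i. 1 / sqrt (real n) * (real (x $ i) - lam n i / mu n i)
           - spare_capacity lam mu n / real CARD('m))"

definition scaled_space ::
  "(nat \<Rightarrow> 'm::finite \<Rightarrow> real) \<Rightarrow> (nat \<Rightarrow> 'm \<Rightarrow> real) \<Rightarrow> nat \<Rightarrow> (real ^ 'm) set" where
  "scaled_space lam mu n = range (scaled lam mu n)"

definition unscaled ::
  "(nat \<Rightarrow> 'm::finite \<Rightarrow> real) \<Rightarrow> (nat \<Rightarrow> 'm \<Rightarrow> real) \<Rightarrow> nat \<Rightarrow> real ^ 'm \<Rightarrow> nat ^ 'm" where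
  "unscaled lam mu n = the_inv (scaled lam mu n)"

lemma inj_scaled: "0 < n \<Longrightarrow> inj (scaled lam mu n)"
  by (auto simp: inj_def scaled_def vec_eq_iff)

lemma unscaled_scaled: "0 < n \<Longrightarrow> unscaled lam mu n (scaled lam mu n x) = x"
  by (simp add: unscaled_def the_inv_f_f inj_scaled)

definition scaled_generator ::
  "(nat \<Rightarrow> 'm::finite \<Rightarrow> real) \<Rightarrow> (nat \<Rightarrow> 'm \<Rightarrow> real) \<Rightarrow> (nat \<Rightarrow> 'm \<Rightarrow> real) \<Rightarrow> nat \<Rightarrow>
   nat ^ 'm \<Rightarrow> (real ^ 'm \<Rightarrow> real) \<Rightarrow> real ^ 'm \<Rightarrow> real" where
  "scaled_generator lam mu gam n z f y =
     queue_generator lam mu gam n z (f \<circ> scaled lam mu n) (unscaled lam mu n y)"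

definition psi :: "real \<Rightarrow> real" where
  "psi t = (if t \<le> -1 then - 1/2
            else if t \<le> 0 then (t + 1) ^ 3 - 1/2 * (t + 1) ^ 4 - 1/2
            else t)"

definition psi_eps :: "real \<Rightarrow> real \<Rightarrow> real" where
  "psi_eps \<epsilon> t = psi (\<epsilon> * t)"

definition lyapunov ::
  "(nat \<Rightarrow> 'm::finite \<Rightarrow> real) \<Rightarrow> nat \<Rightarrow> real \<Rightarrow> real \<Rightarrow> real ^ 'm \<Rightarrow> real" where
  "lyapunov mu n \<theta> \<epsilon> y =
     exp (\<Sum>i\<in>UNIV. (\<epsilon> * \<theta> * psi (- (y $ i)) + psi_eps \<epsilon> (y $ i)) / mu n i)"

end

theory Submission
  imports Defs
begin

text \<open>
  Since \<open>\<theta>\<close> may depend on \<open>n\<close> and the scaled coordinates are bounded below for fixed \<open>n\<close>, for small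
  \<open>\<epsilon>\<close> every arrival multiplies \<open>V\<close> by at most \<open>exp (\<epsilon> / (\<surd>n \<mu>\<^sub>i))\<close> and every departure by at most
  \<open>exp (- (1 - \<delta>) \<epsilon> / (\<surd>n \<mu>\<^sub>i))\<close>. When all servers are busy, the factors \<open>1 / \<mu>\<^sub>i\<close> make the first-order
  drift depend on \<open>z\<close> only through \<open>\<Sum> z\<^sub>i = n\<close>, and it equals \<open>- \<epsilon> \<varrho> V\<close> up to small terms; abandonment only
  helps, and only finitely many states have an idle server.

  For the ergodic part, the generator is known on finitely supported functions only, so the drift
  inequality is applied to \<open>min V K - K\<close>. It yields \<open>E\<^sub>x V(X\<^sub>T) \<le> V(x) / 2 + K\<close> for a suitable \<open>T\<close>. The empty
  state is reachable from everywhere and sublevel sets of \<open>V\<close> are finite, so a coupling argument in the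
  spirit of Hairer and Mattingly makes the law of \<open>X\<^sub>T\<close> contract in a weighted distance.
\<close>

section \<open>The drift inequality\<close>

text \<open>For fixed n the term \<open>psi (- y)\<close> is bounded on the state space, so nothing
  has to be gained from it. \<open>\<theta>\<close> is at most of order
  \<open>\<rho> / sqrt n\<close>, so that the rise of this term at a departure, together with the
  slope that \<open>psi\<close> loses to the left of 0, uses up at most a quarter of the drift;
  second-order terms get another quarter. On the process side, Dynkin's formula is available for
  finitely supported functions only, while the rates are unbounded. Such functions still have
  bounded generator images, because a state has finitely many predecessors under each jump. Applied
  to the indicator of a state, the formula bounds the probability of being away from it after time s
  by its exit rate times s. This gives continuity in time of bounded expectations, hence the
  integrability needed to compare time integrals, and it is the basis of reachability. The
  contraction only acts at multiples of T. A bound on the mean of V that is uniform in time allows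
  it to start from the law at any time, so it controls all real times and makes the laws at
  multiples of T Cauchy on every set; their limit is the invariant law.\<close>

lemma psi_alt:
  "psi t = (max 0 (min t 0 + 1)) ^ 3 - 1/2 * (max 0 (min t 0 + 1)) ^ 4 - 1/2 + max t 0"
proof -
  consider "t < -1" | "t = -1" | "-1 < t" "t \<le> 0" | "0 < t" by linarith
  then show ?thesis by cases (auto simp: psi_def max_def min_def)
qed

text \<open>The derivative \<open>3 * s ^ 2 - 2 * s ^ 3\<close> lies in [0, 1] on the unit interval.
  Its distance from 1 factors as \<open>(1 - s) ^ 2 * (1 + 2 * s)\<close>, which is at most
  \<open>3 * (1 - s)\<close>; this is where the loss \<open>3 * d\<close> comes from.\<close>

lemma quartic_diff_bounds:
  fixes s s' :: real
  assumes "0 \<le> s" "s \<le> s'" "s' \<le> 1" "1 - d \<le> s" "0 \<le> d" "d \<le> 1"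
  shows "(1 - 3 * d) * (s' - s) \<le> (s' ^ 3 - 1/2 * s' ^ 4) - (s ^ 3 - 1/2 * s ^ 4)"
    and "(s' ^ 3 - 1/2 * s' ^ 4) - (s ^ 3 - 1/2 * s ^ 4) \<le> s' - s"
    and "0 \<le> (s' ^ 3 - 1/2 * s' ^ 4) - (s ^ 3 - 1/2 * s ^ 4)"
proof -
  define Q where "Q = (\<lambda>s::real. s ^ 3 - 1/2 * s ^ 4)"
  obtain \<xi> where \<xi>: "s \<le> \<xi>" "\<xi> \<le> s'" "Q s' - Q s = (s' - s) * (3 * \<xi>^2 - 2 * \<xi>^3)"
  proof (cases "s = s'")
    case True
    then show ?thesis using that[of s] by simp
  next
    case False
    have "\<exists>z>s. z < s' \<and> Q s' - Q s = (s' - s) * (3 * z^2 - 2 * z^3)"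
      unfolding Q_def
      by (rule MVT2) (use False assms in \<open>auto intro!: derivative_eq_intros\<close>)
    then show ?thesis using that by (meson less_imp_le)
  qed
  have x: "0 \<le> \<xi>" "\<xi> \<le> 1" "1 - \<xi> \<le> d" using \<xi> assms by auto
  have up: "3 * \<xi>^2 - 2 * \<xi>^3 \<le> 1"
  proof -
    have "0 \<le> (1 - \<xi>)^2 * (1 + 2 * \<xi>)" using x by simp
    also have "\<dots> = 1 - (3 * \<xi>^2 - 2 * \<xi>^3)" by (simp add: power2_eq_square power3_eq_cube algebra_simps)
    finally show ?thesis by simp
  qed
  have "\<xi>^3 \<le> \<xi>^2" using x by (simp add: power_decreasing)
  then have nonneg: "0 \<le> 3 * \<xi>^2 - 2 * \<xi>^3" using zero_le_power2[of \<xi>] by linarith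
  have lo: "1 - 3 * d \<le> 3 * \<xi>^2 - 2 * \<xi>^3"
  proof -
    have "(1 - \<xi>)^2 * (1 + 2 * \<xi>) \<le> (1 - \<xi>) * 3"
      using x by (intro mult_mono) (auto simp: power2_eq_square intro: mult_left_le_one_le)
    also have "\<dots> \<le> 3 * d" using x by simp
    finally show ?thesis by (simp add: power2_eq_square power3_eq_cube algebra_simps)
  qed
  have "(1 - 3 * d) * (s' - s) \<le> Q s' - Q s" "Q s' - Q s \<le> s' - s" "0 \<le> Q s' - Q s"
    using mult_left_mono[OF lo, of "s' - s"] mult_left_mono[OF up, of "s' - s"] nonneg assms \<xi>(3)
    by (simp_all add: mult.commute)
  then show "(1 - 3 * d) * (s' - s) \<le> (s' ^ 3 - 1/2 * s' ^ 4) - (s ^ 3 - 1/2 * s ^ 4)"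
    and "(s' ^ 3 - 1/2 * s' ^ 4) - (s ^ 3 - 1/2 * s ^ 4) \<le> s' - s"
    and "0 \<le> (s' ^ 3 - 1/2 * s' ^ 4) - (s ^ 3 - 1/2 * s ^ 4)"
    unfolding Q_def .
qed

text \<open>\<open>psi_alt\<close> splits \<open>psi\<close> into the quartic of a clamped variable
  \<open>s\<close> and the positive part \<open>p\<close>. Both have nonnegative increments that add
  up to at most \<open>b - a\<close>, which replaces a case distinction on the positions of
  \<open>a\<close> and \<open>b\<close>.\<close>

lemma psi_diff_bounds:
  assumes "a \<le> b"
  shows "0 \<le> psi b - psi a" "psi b - psi a \<le> b - a"
proof -
  define s where "s t = max 0 (min t 0 + 1)" for t :: real
  define p where "p t = max t 0" for t :: real
  have "s b - s a + (p b - p a) \<le> b - a" "0 \<le> p b - p a" using assms by (auto simp: s_def p_def)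
  moreover have "0 \<le> s a" "s a \<le> s b" "s b \<le> 1" using assms by (auto simp: s_def)
  note quartic_diff_bounds(2,3)[OF this, of 1]
  moreover have "psi t = s t ^ 3 - 1/2 * s t ^ 4 - 1/2 + p t" for t
    unfolding s_def p_def by (rule psi_alt)
  moreover have "0 \<le> s a" by (simp add: s_def)
  ultimately show "0 \<le> psi b - psi a" "psi b - psi a \<le> b - a" by simp_all
qed

text \<open>From -1 on the split is exact: \<open>b - a\<close> is the sum of the two increments.
  Only the quartic part loses slope, by at most \<open>3 * d\<close>, since \<open>s\<close> stays
  within \<open>d\<close> of 1.\<close>

lemma psi_diff_lower:
  assumes "a \<le> b" "- d \<le> a" "0 \<le> d" "d \<le> 1"
  shows "(1 - 3 * d) * (b - a) \<le> psi b - psi a"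
proof -
  define s where "s t = max 0 (min t 0 + 1)" for t :: real
  define p where "p t = max t 0" for t :: real
  have eq: "b - a = (s b - s a) + (p b - p a)" and p: "0 \<le> p b - p a"
    using assms by (auto simp: s_def p_def)
  have "0 \<le> s a" "s a \<le> s b" "s b \<le> 1" "1 - d \<le> s a" using assms by (auto simp: s_def)
  note quartic_diff_bounds(1)[OF this assms(3,4)]
  moreover have "(1 - 3 * d) * (p b - p a) \<le> p b - p a"
    using mult_nonneg_nonneg[of "3 * d" "p b - p a"] assms p by (auto simp: algebra_simps)
  moreover have "psi t = s t ^ 3 - 1/2 * s t ^ 4 - 1/2 + p t" for t
    unfolding s_def p_def by (rule psi_alt)
  ultimately show ?thesis unfolding eq distrib_left by simp
qed

lemma psi_ge: "- 1/2 \<le> psi t" "t \<le> psi t"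
  using psi_diff_bounds[of "-1" t] psi_diff_bounds[of t 0] by (auto simp: psi_def)

section \<open>Effect of one arrival or departure on the logarithm of V\<close>

definition log_lyapunov :: "real \<Rightarrow> real \<Rightarrow> real \<Rightarrow> real" where
  "log_lyapunov \<theta> \<epsilon> t = \<epsilon> * \<theta> * psi (- t) + psi_eps \<epsilon> t"

text \<open>An arrival can only lower the \<open>\<theta>\<close> term, because \<open>psi\<close>
  is monotone; the other term has slope at most \<open>\<epsilon>\<close>.\<close>

lemma log_lyapunov_up:
  assumes "0 < \<epsilon>" "0 < \<theta>" "0 \<le> h"
  shows "log_lyapunov \<theta> \<epsilon> (t + h) - log_lyapunov \<theta> \<epsilon> t \<le> \<epsilon> * h"
proof -
  have "\<epsilon> * \<theta> * psi (- (t + h)) \<le> \<epsilon> * \<theta> * psi (- t)"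
    using psi_diff_bounds(1)[of "- (t + h)" "- t"] assms by (intro mult_left_mono) auto
  moreover have "psi (\<epsilon> * (t + h)) - psi (\<epsilon> * t) \<le> \<epsilon> * h"
    using psi_diff_bounds(2)[of "\<epsilon> * t" "\<epsilon> * (t + h)"] assms by (auto simp: algebra_simps)
  ultimately show ?thesis by (simp add: log_lyapunov_def psi_eps_def)
qed

text \<open>Here the \<open>\<theta>\<close> term rises by at most
  \<open>\<epsilon> * \<theta> * h\<close>, against a fall of at least
  \<open>(1 - 3 * d) * (\<epsilon> * h)\<close> in the other term. The position after the jump is
  the lower end of the interval crossed, so the lower bound is imposed there.\<close>

lemma log_lyapunov_down:
  assumes "0 < \<epsilon>" "0 < \<theta>" "0 \<le> h" "- d \<le> \<epsilon> * (t - h)" "0 \<le> d" "d \<le> 1"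
  shows "log_lyapunov \<theta> \<epsilon> (t - h) - log_lyapunov \<theta> \<epsilon> t \<le> - (\<epsilon> * h * (1 - (3 * d + \<theta>)))"
proof -
  have "\<epsilon> * \<theta> * (psi (- (t - h)) - psi (- t)) \<le> \<epsilon> * \<theta> * h"
    using psi_diff_bounds(2)[of "- t" "- (t - h)"] assms by (intro mult_left_mono) auto
  moreover have "(1 - 3 * d) * (\<epsilon> * h) \<le> psi (\<epsilon> * t) - psi (\<epsilon> * (t - h))"
    using psi_diff_lower[of "\<epsilon> * (t - h)" "\<epsilon> * t" d] assms by (auto simp: algebra_simps)
  ultimately show ?thesis by (simp add: log_lyapunov_def psi_eps_def algebra_simps)
qed

lemma scaled_add_axis:
  "scaled lam mu n (x + axis i 1) $ j
     = scaled lam mu n x $ j + (if j = i then 1 / sqrt (real n) else 0)"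
  by (auto simp: scaled_def axis_def algebra_simps add_divide_distrib)

lemma scaled_diff_axis:
  "0 < x $ i \<Longrightarrow> scaled lam mu n (x - axis i 1) $ j
     = scaled lam mu n x $ j - (if j = i then 1 / sqrt (real n) else 0)"
  by (auto simp: scaled_def axis_def algebra_simps diff_divide_distrib)

lemma lyapunov_change_coordinate:
  assumes "\<And>j. j \<noteq> i \<Longrightarrow> y' $ j = y $ j"
  shows "lyapunov mu n \<theta> \<epsilon> y' = lyapunov mu n \<theta> \<epsilon> y
     * exp ((log_lyapunov \<theta> \<epsilon> (y' $ i) - log_lyapunov \<theta> \<epsilon> (y $ i)) / mu n i)"
proof -
  have "(\<Sum>j\<in>UNIV. log_lyapunov \<theta> \<epsilon> (y' $ j) / mu n j) = (\<Sum>j\<in>UNIV. log_lyapunov \<theta> \<epsilon> (y $ j) / mu n j)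
      + (log_lyapunov \<theta> \<epsilon> (y' $ i) - log_lyapunov \<theta> \<epsilon> (y $ i)) / mu n i"
    using assms by (simp add: sum.remove[of UNIV i] diff_divide_distrib)
  then show ?thesis
    by (simp add: lyapunov_def exp_add flip: log_lyapunov_def)
qed

lemma lyapunov_pos: "0 < lyapunov mu n \<theta> \<epsilon> y"
  by (simp add: lyapunov_def)

lemma exp_neg_le_quadratic: "exp (- b) \<le> 1 - b + b\<^sup>2" if "0 \<le> b" for b :: real
proof -
  have "exp (- b) \<le> 1 / (1 + b)"
    using exp_ge_add_one_self[of b] that by (simp add: exp_minus field_simps)
  also have "\<dots> \<le> 1 - b + b\<^sup>2"
  proof -
    have "(1 - b + b\<^sup>2) * (1 + b) = 1 + b ^ 3" by (simp add: power2_eq_square power3_eq_cube algebra_simps)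
    then show ?thesis using that by (simp add: pos_divide_le_eq)
  qed
  finally show ?thesis .
qed

text \<open>To first order, class i contributes \<open>\<epsilon> * h * (lam n i / mu n i)\<close>
  by arrivals and at most \<open>- \<epsilon> * h * (1 - k) * z i\<close> by departures, with
  \<open>k = 3 * d + \<theta>\<close>. The sums are \<open>\<epsilon> * (sqrt n - \<rho>)\<close>
  and \<open>- \<epsilon> * (1 - k) * sqrt n\<close>. The squares of \<open>a i\<close> are the
  second-order errors of the exponentials.\<close>

lemma queue_drift_saturated:
  fixes lam mu gam :: "nat \<Rightarrow> 'm::finite \<Rightarrow> real" and n :: nat
  defines "h \<equiv> 1 / sqrt (real n)" and "\<rho> \<equiv> spare_capacity lam mu n"
  assumes n: "0 < n" and lam: "\<And>i. 0 \<le> lam n i" and mu: "\<And>i. 0 < mu n i" and gam: "\<And>i. 0 \<le> gam n i"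
    and z: "z \<in> work_conserving n x" and x: "n \<le> (\<Sum>i\<in>UNIV. x $ i)"
    and \<theta>: "0 < \<theta>" and d: "0 \<le> d" "3 * d + \<theta> \<le> 1" and \<epsilon>: "0 < \<epsilon>"
    and small: "\<And>i. \<epsilon> * (h * (lam n i / mu n i + 1) + \<rho> / real CARD('m)) \<le> d" "\<And>i. \<epsilon> * h / mu n i \<le> 1"
  shows "queue_generator lam mu gam n z (lyapunov mu n \<theta> \<epsilon> \<circ> scaled lam mu n) x
     \<le> \<epsilon> * (- \<rho> + (3 * d + \<theta>) * sqrt (real n)
            + \<epsilon> * (\<Sum>i\<in>UNIV. (lam n i + mu n i * real n) * (h / mu n i)\<^sup>2)) * lyapunov mu n \<theta> \<epsilon> (scaled lam mu n x)"
proof -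
  define V where "V = lyapunov mu n \<theta> \<epsilon> (scaled lam mu n x)"
  define k where "k = 3 * d + \<theta>"
  define a where "a i = \<epsilon> * h / mu n i" for i
  have V: "0 < V" by (simp add: V_def lyapunov_pos)
  have h: "0 < h" using n by (simp add: h_def)
  have k: "0 \<le> k" "k \<le> 1" using \<theta> d by (auto simp: k_def)
  have a: "0 < a i" "a i \<le> 1" for i using \<epsilon> h mu[of i] small(2)[of i] by (auto simp: a_def)
  have zx: "z $ i \<le> x $ i" for i using z by (simp add: work_conserving_def)
  have zsum: "(\<Sum>i\<in>UNIV. z $ i) = n" using z x by (simp add: work_conserving_def)
  have zn: "z $ i \<le> n" for i unfolding zsum[symmetric] by (rule member_le_sum) auto
  let ?W = "lyapunov mu n \<theta> \<epsilon> \<circ> scaled lam mu n"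
  have up: "lam n i * (?W (x + axis i 1) - ?W x) \<le> lam n i * (a i + (a i)\<^sup>2) * V" for i
  proof -
    have "(log_lyapunov \<theta> \<epsilon> (scaled lam mu n x $ i + h) - log_lyapunov \<theta> \<epsilon> (scaled lam mu n x $ i)) / mu n i \<le> a i"
      unfolding a_def using log_lyapunov_up[OF \<epsilon> \<theta> less_imp_le[OF h]] mu[of i] by (intro divide_right_mono) auto
    then have "?W (x + axis i 1) \<le> V * exp (a i)"
      using lyapunov_change_coordinate[of i "scaled lam mu n (x + axis i 1)" "scaled lam mu n x" mu n \<theta> \<epsilon>] V
      by (simp add: scaled_add_axis h_def V_def del: One_nat_def)
    also have "\<dots> \<le> V * (1 + a i + (a i)\<^sup>2)"
      using exp_bound[of "a i"] a[of i] V by (intro mult_left_mono) auto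
    finally have "?W (x + axis i 1) - ?W x \<le> (a i + (a i)\<^sup>2) * V"
      by (simp add: V_def algebra_simps)
    from mult_left_mono[OF this lam[of i]] show ?thesis by (simp add: mult.assoc)
  qed
  have down: "(mu n i * real (z $ i) + gam n i * (real (x $ i) - real (z $ i))) * (?W (x - axis i 1) - ?W x)
      \<le> mu n i * real (z $ i) * (- (a i * (1 - k)) + (a i)\<^sup>2) * V" for i
  proof (cases "x $ i = 0")
    case True
    then show ?thesis using zx[of i] by simp
  next
    case False
    \<comment> \<open>No coordinate lies below the one of an empty class; the additional
      \<open>h\<close> in the smallness assumption covers the jump.\<close>
    have low: "- d \<le> \<epsilon> * (scaled lam mu n x $ i - h)"
    proof -
      have "- (h * (lam n i / mu n i + 1) + \<rho> / real CARD('m)) \<le> scaled lam mu n x $ i - h"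
        using h by (simp add: scaled_def \<rho>_def algebra_simps flip: h_def)
      from mult_left_mono[OF this less_imp_le[OF \<epsilon>]] small(1)[of i] show ?thesis by linarith
    qed
    have d1: "d \<le> 1" using d \<theta> by linarith
    have "(log_lyapunov \<theta> \<epsilon> (scaled lam mu n x $ i - h) - log_lyapunov \<theta> \<epsilon> (scaled lam mu n x $ i)) / mu n i
        \<le> - (a i * (1 - k))"
      using divide_right_mono[OF log_lyapunov_down[OF \<epsilon> \<theta> less_imp_le[OF h] low d(1) d1], of "mu n i"] mu[of i]
      by (simp add: a_def k_def)
    then have "?W (x - axis i 1) \<le> V * exp (- (a i * (1 - k)))"
      using lyapunov_change_coordinate[of i "scaled lam mu n (x - axis i 1)" "scaled lam mu n x" mu n \<theta> \<epsilon>] V False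
      by (simp add: scaled_diff_axis h_def V_def del: One_nat_def)
    then have *: "?W (x - axis i 1) - ?W x \<le> V * (exp (- (a i * (1 - k))) - 1)"
      by (simp add: V_def algebra_simps)
    have ak: "0 \<le> a i * (1 - k)" "a i * (1 - k) \<le> a i" using a[of i] k by (auto simp: mult_left_le)
    have e0: "exp (- (a i * (1 - k))) - 1 \<le> 0" using ak by simp
    have "exp (- (a i * (1 - k))) - 1 \<le> - (a i * (1 - k)) + (a i * (1 - k))\<^sup>2"
      using exp_neg_le_quadratic[OF ak(1)] by simp
    also have "\<dots> \<le> - (a i * (1 - k)) + (a i)\<^sup>2"
      using ak by (simp add: power_mono)
    finally have e1: "exp (- (a i * (1 - k))) - 1 \<le> - (a i * (1 - k)) + (a i)\<^sup>2" .
    have r: "0 \<le> mu n i * real (z $ i)" "0 \<le> gam n i * (real (x $ i) - real (z $ i))"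
      using mu[of i] gam[of i] zx[of i] by auto
    have "(mu n i * real (z $ i) + gam n i * (real (x $ i) - real (z $ i))) * (?W (x - axis i 1) - ?W x)
        \<le> (mu n i * real (z $ i) + gam n i * (real (x $ i) - real (z $ i))) * (V * (exp (- (a i * (1 - k))) - 1))"
      using r by (intro mult_left_mono[OF *]) auto
    \<comment> \<open>The bracket is nonpositive because \<open>k \<le> 1\<close>, so dropping the
      abandonment rate can only increase the expression.\<close>
    also have "\<dots> \<le> mu n i * real (z $ i) * (V * (exp (- (a i * (1 - k))) - 1))"
      using r V e0 by (intro mult_right_mono_neg) (auto simp: mult_nonneg_nonpos)
    also have "\<dots> \<le> mu n i * real (z $ i) * (V * (- (a i * (1 - k)) + (a i)\<^sup>2))"
      using r V by (intro mult_left_mono e1) auto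
    finally show ?thesis by (simp add: mult_ac)
  qed
  have mua: "mu n i * a i = \<epsilon> * h" for i using mu[of i] by (simp add: a_def)
  have lama: "lam n i * a i = \<epsilon> * h * (lam n i / mu n i)" for i by (simp add: a_def)
  have load: "h * (\<Sum>i\<in>UNIV. lam n i / mu n i) = sqrt (real n) - \<rho>"
  proof -
    have "(\<Sum>i\<in>UNIV. lam n i / (real n * mu n i)) = (\<Sum>i\<in>UNIV. lam n i / mu n i) / real n"
      by (simp add: sum_divide_distrib mult.commute)
    moreover have "h = sqrt (real n) / real n" using n by (simp add: h_def sqrt_divide_self_eq inverse_eq_divide)
    ultimately show ?thesis by (simp only: \<rho>_def spare_capacity_def) (simp add: algebra_simps)
  qed
  have hn: "h * real n = sqrt (real n)" using n by (simp add: h_def real_div_sqrt)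
  have "queue_generator lam mu gam n z ?W x
      \<le> (\<Sum>i\<in>UNIV. lam n i * (a i + (a i)\<^sup>2) * V) + (\<Sum>i\<in>UNIV. mu n i * real (z $ i) * (- (a i * (1 - k)) + (a i)\<^sup>2) * V)"
    unfolding queue_generator_def by (intro add_mono sum_mono up down)
  also have "\<dots> = (\<Sum>i\<in>UNIV. \<epsilon> * h * (lam n i / mu n i) - \<epsilon> * h * (1 - k) * real (z $ i) + (lam n i + mu n i * real (z $ i)) * (a i)\<^sup>2) * V"
  proof -
    have "lam n i * (a i + (a i)\<^sup>2) * V + mu n i * real (z $ i) * (- (a i * (1 - k)) + (a i)\<^sup>2) * V =
       (lam n i * a i - mu n i * a i * (1 - k) * real (z $ i) + (lam n i + mu n i * real (z $ i)) * (a i)\<^sup>2) * V" for i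
      by (simp add: algebra_simps)
    then show ?thesis unfolding lama mua by (simp add: sum_distrib_right sum.distrib[symmetric])
  qed
  \<comment> \<open>In the first-order part \<open>z\<close> is kept, since its sum is known
    exactly; in the second-order part \<open>z i \<le> n\<close> is enough.\<close>
  also have "\<dots> \<le> (\<Sum>i\<in>UNIV. \<epsilon> * h * (lam n i / mu n i) - \<epsilon> * h * (1 - k) * real (z $ i) + (lam n i + mu n i * real n) * (a i)\<^sup>2) * V"
    using V mu zn by (intro mult_right_mono sum_mono add_left_mono mult_left_mono add_mono) (auto simp: less_imp_le)
  also have "\<dots> = (\<epsilon> * (h * (\<Sum>i\<in>UNIV. lam n i / mu n i)) - \<epsilon> * (1 - k) * (h * real (\<Sum>i\<in>UNIV. z $ i))
       + (\<Sum>i\<in>UNIV. (lam n i + mu n i * real n) * (a i)\<^sup>2)) * V"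
    by (simp add: sum.distrib sum_subtractf sum_distrib_left mult_ac)
  also have "\<dots> = (\<epsilon> * (- \<rho> + k * sqrt (real n)) + (\<Sum>i\<in>UNIV. (lam n i + mu n i * real n) * (a i)\<^sup>2)) * V"
    unfolding load zsum hn by (simp add: algebra_simps)
  also have "(\<Sum>i\<in>UNIV. (lam n i + mu n i * real n) * (a i)\<^sup>2)
     = \<epsilon> * (\<epsilon> * (\<Sum>i\<in>UNIV. (lam n i + mu n i * real n) * (h / mu n i)\<^sup>2))"
    by (simp add: a_def sum_distrib_left power2_eq_square mult_ac)
  finally show ?thesis by (simp only: V_def k_def distrib_left)
qed

section \<open>Finite sets of states and the drift inequality on all states\<close>

lemma finite_vec_bounded: "finite {x :: nat ^ 'm::finite. \<forall>i. x $ i \<le> N i}"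
proof -
  have "{x :: nat ^ 'm. \<forall>i. x $ i \<le> N i} \<subseteq> vec_lambda ` (\<Pi>\<^sub>E i\<in>UNIV. {..N i})"
  proof
    fix x :: "nat ^ 'm" assume "x \<in> {x. \<forall>i. x $ i \<le> N i}"
    then have "x = vec_lambda (vec_nth x)" "vec_nth x \<in> (\<Pi>\<^sub>E i\<in>UNIV. {..N i})" by auto
    then show "x \<in> vec_lambda ` (\<Pi>\<^sub>E i\<in>UNIV. {..N i})" by (rule image_eqI)
  qed
  then show ?thesis by (rule finite_subset) (auto intro!: finite_PiE)
qed

lemma finite_work_conserving: "finite (work_conserving n x)"
  by (rule finite_subset[OF _ finite_vec_bounded[of "vec_nth x"]]) (auto simp: work_conserving_def)

lemma eventually_small_mult: "\<forall>\<^sub>F \<epsilon>::real in at_right 0. \<epsilon> * b < c" if "0 < c"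
proof -
  have "((\<lambda>\<epsilon>::real. \<epsilon> * b) \<longlongrightarrow> 0 * b) (at_right 0)" by (intro tendsto_intros)
  then show ?thesis using that by (auto dest: order_tendstoD(2))
qed

lemma queue_drift:
  fixes lam mu gam :: "nat \<Rightarrow> 'm::finite \<Rightarrow> real" and n :: nat
  assumes lam: "\<And>i. 0 \<le> lam n i" and mu: "\<And>i. 0 < mu n i" and gam: "\<And>i. 0 \<le> gam n i"
    and spare: "0 < spare_capacity lam mu n"
  obtains \<theta> \<epsilon>\<^sub>0 and C :: "real \<Rightarrow> real" where "0 < \<theta>" "0 < \<epsilon>\<^sub>0"
    "\<And>\<epsilon>. 0 < \<epsilon> \<Longrightarrow> \<epsilon> < \<epsilon>\<^sub>0 \<Longrightarrow> 0 < C \<epsilon>"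
    "\<And>\<epsilon> x z. 0 < \<epsilon> \<Longrightarrow> \<epsilon> < \<epsilon>\<^sub>0 \<Longrightarrow> z \<in> work_conserving n x \<Longrightarrow>
       queue_generator lam mu gam n z (lyapunov mu n \<theta> \<epsilon> \<circ> scaled lam mu n) x
         \<le> C \<epsilon> - \<epsilon> * (spare_capacity lam mu n / (2 * real CARD('m))) * lyapunov mu n \<theta> \<epsilon> (scaled lam mu n x)"
proof -
  define \<rho> where "\<rho> = spare_capacity lam mu n"
  define h where "h = 1 / sqrt (real n)"
  have n: "0 < n" using spare by (cases "n = 0") (auto simp: spare_capacity_def)
  \<comment> \<open>The saturated bound is used with \<open>d = \<theta>\<close>, so the slope
    deficit is \<open>4 * \<theta>\<close>. The value 1/4 keeps it at most 1, and
    \<open>\<rho> / (16 * sqrt n)\<close> keeps its cost at most \<open>\<rho> / 4\<close>.\<close>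
  define \<theta> where "\<theta> = min (1/4) (\<rho> / (16 * sqrt (real n)))"
  define K where "K = (\<Sum>i\<in>UNIV. (lam n i + mu n i * real n) * (h / mu n i)\<^sup>2)"
  define c where "c \<epsilon> = \<epsilon> * (\<rho> / (2 * real CARD('m)))" for \<epsilon>
  have \<rho>: "0 < \<rho>" using spare by (simp add: \<rho>_def)
  have \<theta>: "0 < \<theta>" using \<rho> n by (simp add: \<theta>_def)
  have \<theta>1: "3 * \<theta> + \<theta> \<le> 1" by (simp add: \<theta>_def)
  have \<theta>2: "(3 * \<theta> + \<theta>) * sqrt (real n) \<le> \<rho> / 4"
  proof -
    have "4 * \<theta> * sqrt (real n) \<le> 4 * (\<rho> / (16 * sqrt (real n))) * sqrt (real n)"
      by (intro mult_right_mono mult_left_mono) (auto simp: \<theta>_def)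
    then show ?thesis using n by simp
  qed
  have "\<forall>\<^sub>F \<epsilon>::real in at_right 0. (\<forall>i. \<epsilon> * (h * (lam n i / mu n i + 1) + \<rho> / real CARD('m)) < \<theta>)
      \<and> (\<forall>i. \<epsilon> * (h / mu n i) < 1) \<and> \<epsilon> * K < \<rho> / 4"
    using \<theta> \<rho> by (intro eventually_conj eventually_all_finite eventually_small_mult) auto
  then obtain \<epsilon>\<^sub>0 where \<epsilon>\<^sub>0: "0 < \<epsilon>\<^sub>0"
    and small: "\<And>\<epsilon>. 0 < \<epsilon> \<Longrightarrow> \<epsilon> < \<epsilon>\<^sub>0 \<Longrightarrow>
      (\<forall>i. \<epsilon> * (h * (lam n i / mu n i + 1) + \<rho> / real CARD('m)) < \<theta>)
      \<and> (\<forall>i. \<epsilon> * (h / mu n i) < 1) \<and> \<epsilon> * K < \<rho> / 4"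
    by (auto simp: eventually_at_right_field)
  define F where "F = {x :: nat ^ 'm. (\<Sum>i\<in>UNIV. x $ i) < n}"
  have F: "finite F"
  proof (rule finite_subset[OF _ finite_vec_bounded[of "\<lambda>_. n"]])
    show "F \<subseteq> {x. \<forall>i. x $ i \<le> n}"
      unfolding F_def by (auto intro: order_trans[OF member_le_sum[of _ UNIV] less_imp_le])
  qed
  define R where "R \<epsilon> x z = queue_generator lam mu gam n z (lyapunov mu n \<theta> \<epsilon> \<circ> scaled lam mu n) x
      + c \<epsilon> * lyapunov mu n \<theta> \<epsilon> (scaled lam mu n x)" for \<epsilon> x z
  \<comment> \<open>A crude maximum: the sum of all excesses over the finitely many states with an
    idle server and their actions. The summand 1 makes \<open>C\<close> positive.\<close>
  define C where "C \<epsilon> = 1 + (\<Sum>x\<in>F. \<Sum>z\<in>work_conserving n x. \<bar>R \<epsilon> x z\<bar>)" for \<epsilon>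
  have C: "1 \<le> C \<epsilon>" for \<epsilon> by (auto simp: C_def intro!: sum_nonneg)
  have "R \<epsilon> x z \<le> C \<epsilon>" if \<epsilon>: "0 < \<epsilon>" "\<epsilon> < \<epsilon>\<^sub>0" and z: "z \<in> work_conserving n x" for \<epsilon> x z
  proof (cases "x \<in> F")
    case True
    have "\<bar>R \<epsilon> x z\<bar> \<le> (\<Sum>z\<in>work_conserving n x. \<bar>R \<epsilon> x z\<bar>)"
      using z finite_work_conserving by (intro member_le_sum) auto
    also have "\<dots> \<le> (\<Sum>x\<in>F. \<Sum>z\<in>work_conserving n x. \<bar>R \<epsilon> x z\<bar>)"
      using True F by (intro member_le_sum) (auto intro: sum_nonneg)
    finally show ?thesis by (simp add: C_def)
  next
    case False
    let ?V = "lyapunov mu n \<theta> \<epsilon> (scaled lam mu n x)"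
    have "queue_generator lam mu gam n z (lyapunov mu n \<theta> \<epsilon> \<circ> scaled lam mu n) x
       \<le> \<epsilon> * (- \<rho> + (3 * \<theta> + \<theta>) * sqrt (real n) + \<epsilon> * K) * ?V"
      unfolding \<rho>_def K_def h_def
      using False n lam mu gam z \<theta> \<theta>1 \<epsilon> small[OF \<epsilon>]
      by (intro queue_drift_saturated) (auto simp: F_def \<rho>_def h_def less_imp_le)
    \<comment> \<open>One quarter of \<open>\<rho>\<close> pays for the slope deficit, one for the
      second-order terms; the remaining \<open>\<rho> / 2\<close> is at least the required
      \<open>\<rho> / (2 * CARD('m))\<close>.\<close>
    also have "\<dots> \<le> \<epsilon> * (- \<rho> + \<rho> / 4 + \<rho> / 4) * ?V"
      using \<theta>2 small[OF \<epsilon>] \<epsilon> lyapunov_pos[of mu n \<theta> \<epsilon> "scaled lam mu n x"]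
      by (intro mult_right_mono mult_left_mono add_mono) auto
    also have "\<dots> \<le> - (c \<epsilon> * ?V)"
    proof -
      have "1 * real CARD('m) \<ge> 1" by simp
      then have "\<rho> / (2 * real CARD('m)) \<le> \<rho> / 2" using \<rho> by (intro divide_left_mono) auto
      then have "\<epsilon> * (\<rho> / (2 * real CARD('m))) * ?V \<le> \<epsilon> * (\<rho> / 2) * ?V"
        using \<epsilon> lyapunov_pos[of mu n \<theta> \<epsilon> "scaled lam mu n x"] by (intro mult_right_mono mult_left_mono) auto
      then show ?thesis by (simp add: c_def algebra_simps)
    qed
    finally show ?thesis using C[of \<epsilon>] by (simp add: R_def)
  qed
  then show ?thesis
    using C \<theta> \<epsilon>\<^sub>0 by (intro that[of \<theta> \<epsilon>\<^sub>0 C]) (auto simp: R_def c_def \<rho>_def intro: less_le_trans[OF zero_less_one] add_le_imp_le_diff)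
qed

text \<open>Since \<open>psi t\<close> is at least both -1/2 and \<open>t\<close>, log V is at least
  \<open>\<epsilon> * y i / mu n i - B\<close> for every i, so a bound on V bounds every
  coordinate.\<close>

lemma finite_lyapunov_sublevel:
  fixes lam mu :: "nat \<Rightarrow> 'm::finite \<Rightarrow> real"
  assumes n: "0 < n" and mu: "\<And>i. 0 < mu n i" and \<epsilon>: "0 < \<epsilon>" and \<theta>: "0 < \<theta>"
  shows "finite {x. lyapunov mu n \<theta> \<epsilon> (scaled lam mu n x) \<le> K}"
proof -
  define B where "B = (\<Sum>i\<in>UNIV. (\<epsilon> * \<theta> + 1) / (2 * mu n i))"
  define b where "b i = sqrt (real n) * (mu n i * (\<bar>ln K\<bar> + 2 * B) / \<epsilon> + spare_capacity lam mu n / real CARD('m)) + lam n i / mu n i" for i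
  have "x $ i \<le> nat \<lceil>b i\<rceil>" if K: "lyapunov mu n \<theta> \<epsilon> (scaled lam mu n x) \<le> K" for x i
  proof -
    let ?y = "scaled lam mu n x"
    let ?g = "\<lambda>j. log_lyapunov \<theta> \<epsilon> (?y $ j) / mu n j"
    have low: "- ((\<epsilon> * \<theta> + 1) / (2 * mu n j)) \<le> ?g j" for j
    proof -
      have "\<epsilon> * \<theta> * (- 1/2) \<le> \<epsilon> * \<theta> * psi (- (?y $ j))" using psi_ge(1)[of "- (?y $ j)"] \<epsilon> \<theta> by (intro mult_left_mono) auto
      then have "- (\<epsilon> * \<theta> + 1) / 2 \<le> log_lyapunov \<theta> \<epsilon> (?y $ j)"
        using psi_ge(1)[of "\<epsilon> * ?y $ j"] by (simp add: log_lyapunov_def psi_eps_def)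
      from divide_right_mono[OF this, of "mu n j"] mu[of j] show ?thesis by (simp add: minus_divide_left)
    qed
    have lowi: "\<epsilon> * ?y $ i / mu n i - (\<epsilon> * \<theta> + 1) / (2 * mu n i) \<le> ?g i"
    proof -
      have "\<epsilon> * \<theta> * (- 1/2) \<le> \<epsilon> * \<theta> * psi (- (?y $ i))" using psi_ge(1)[of "- (?y $ i)"] \<epsilon> \<theta> by (intro mult_left_mono) auto
      then have "\<epsilon> * ?y $ i - (\<epsilon> * \<theta> + 1) / 2 \<le> log_lyapunov \<theta> \<epsilon> (?y $ i)"
        using psi_ge(2)[of "\<epsilon> * ?y $ i"] by (simp add: log_lyapunov_def psi_eps_def add_divide_distrib)
      from divide_right_mono[OF this, of "mu n i"] mu[of i] show ?thesis by (simp add: diff_divide_distrib)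
    qed
    have "(\<Sum>j\<in>UNIV. ?g j) \<le> ln K"
    proof -
      have "lyapunov mu n \<theta> \<epsilon> ?y = exp (\<Sum>j\<in>UNIV. ?g j)" by (simp add: lyapunov_def log_lyapunov_def)
      then show ?thesis using K by (metis exp_gt_zero less_le_trans ln_exp ln_le_cancel_iff)
    qed
    moreover have "(\<Sum>j\<in>UNIV. ?g j) \<ge> \<epsilon> * ?y $ i / mu n i - B"
      using sum_mono[of "UNIV - {i}" "\<lambda>j. - ((\<epsilon> * \<theta> + 1) / (2 * mu n j))" ?g, OF low] lowi
      by (simp add: B_def sum.remove[of UNIV i] sum_negf)
    moreover have "0 \<le> B" using mu \<epsilon> \<theta> by (auto simp: B_def less_imp_le intro!: sum_nonneg divide_nonneg_nonneg)
    ultimately have "\<epsilon> * ?y $ i / mu n i \<le> \<bar>ln K\<bar> + 2 * B" by linarith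
    then have "?y $ i \<le> mu n i * (\<bar>ln K\<bar> + 2 * B) / \<epsilon>" using \<epsilon> mu[of i] by (simp add: field_simps)
    then have "1 / sqrt (real n) * (real (x $ i) - lam n i / mu n i)
        \<le> mu n i * (\<bar>ln K\<bar> + 2 * B) / \<epsilon> + spare_capacity lam mu n / real CARD('m)"
      by (simp add: scaled_def)
    from mult_left_mono[OF this, of "sqrt (real n)"]
    have "real (x $ i) \<le> b i" using n by (simp add: b_def)
    then show ?thesis by linarith
  qed
  then show ?thesis by (intro finite_subset[OF _ finite_vec_bounded[of "\<lambda>i. nat \<lceil>b i\<rceil>"]]) auto
qed

section \<open>Contraction of Markov kernels by coupling\<close>

text \<open>Stated with the nonnegative integral, so that it makes sense before integrability is
  known and passes through \<open>bind_pmf\<close>. For nonnegative \<open>f\<close> and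
  \<open>M\<close> it means that the mean exists and is at most \<open>M\<close>.\<close>

definition mean_le :: "'a pmf \<Rightarrow> ('a \<Rightarrow> real) \<Rightarrow> real \<Rightarrow> bool" where
  "mean_le p f M \<longleftrightarrow> (\<integral>\<^sup>+x. ennreal (f x) \<partial>measure_pmf p) \<le> ennreal M"

lemma mean_leI:
  assumes "\<And>x. 0 \<le> f x" "integrable (measure_pmf p) f" "measure_pmf.expectation p f \<le> M"
  shows "mean_le p f M"
  using assms by (simp add: mean_le_def nn_integral_eq_integral ennreal_leI)

lemma mean_leD:
  assumes "\<And>x. 0 \<le> f x" "0 \<le> M" "mean_le p f M"
  shows "integrable (measure_pmf p) f" "measure_pmf.expectation p f \<le> M"
proof -
  show int: "integrable (measure_pmf p) f"
    using assms by (intro integrableI_bounded) (auto simp: mean_le_def intro: le_less_trans)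
  show "measure_pmf.expectation p f \<le> M"
    using assms int by (simp add: mean_le_def nn_integral_eq_integral)
qed

lemma mean_le_mono: "mean_le p f M \<Longrightarrow> M \<le> N \<Longrightarrow> mean_le p f N"
  unfolding mean_le_def by (erule order_trans) (rule ennreal_leI)

lemma mean_le_return: "mean_le (return_pmf x) f (f x)"
  by (simp add: mean_le_def)

lemma mean_le_bind:
  assumes f: "\<And>x. 0 \<le> f x" and ab: "0 \<le> a" "0 \<le> b" and M: "0 \<le> M" "mean_le p f M"
    and Q: "\<And>x. mean_le (Q x) g (a * f x + b)"
  shows "mean_le (bind_pmf p Q) g (a * M + b)"
proof -
  have "(\<integral>\<^sup>+x. ennreal (g x) \<partial>measure_pmf (bind_pmf p Q)) \<le> (\<integral>\<^sup>+x. ennreal a * ennreal (f x) + ennreal b \<partial>measure_pmf p)"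
    using Q f ab by (auto simp: mean_le_def ennreal_mult' intro!: nn_integral_mono)
  also have "\<dots> = ennreal a * (\<integral>\<^sup>+x. ennreal (f x) \<partial>measure_pmf p) + ennreal b"
    by (simp add: nn_integral_add nn_integral_cmult)
  also have "\<dots> \<le> ennreal a * ennreal M + ennreal b"
    using M by (auto simp: mean_le_def intro!: add_right_mono mult_left_mono)
  also have "\<dots> = ennreal (a * M + b)" using ab M by (simp add: ennreal_mult')
  finally show ?thesis by (simp add: mean_le_def)
qed

lemma integrable_pmf_bounded:
  fixes f :: "'a \<Rightarrow> real"
  assumes "\<And>x. \<bar>f x\<bar> \<le> b"
  shows "integrable (measure_pmf p) f"
  using assms by (intro measure_pmf.integrable_const_bound[where B = b]) auto

lemma expectation_bounded:
  fixes f :: "'a \<Rightarrow> real"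
  assumes "\<And>x. \<bar>f x\<bar> \<le> b"
  shows "\<bar>measure_pmf.expectation p f\<bar> \<le> b"
proof -
  have "\<bar>measure_pmf.expectation p f\<bar> \<le> measure_pmf.expectation p (\<lambda>x. \<bar>f x\<bar>)" by (rule integral_abs_bound)
  also have "\<dots> \<le> measure_pmf.expectation p (\<lambda>x. b)"
    by (intro integral_mono integrable_pmf_bounded[of _ b]) (use assms in \<open>auto intro: order_trans[OF abs_ge_zero]\<close>)
  finally show ?thesis by simp
qed

lemma expectation_bind_bounded:
  fixes f :: "'b \<Rightarrow> real"
  assumes "\<And>x. \<bar>f x\<bar> \<le> b"
  shows "measure_pmf.expectation (bind_pmf p Q) f
    = measure_pmf.expectation p (\<lambda>x. measure_pmf.expectation (Q x) f)"
  unfolding measure_pmf_bind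
  using assms measurable_measure_pmf[of Q] measure_pmf.finite_measure_axioms
  by (intro integral_bind[where K = "count_space UNIV" and B = b and B' = 1])
     (auto simp: measure_pmf.emeasure_space_1)

text \<open>Monotone convergence. Dynkin's formula controls bounded truncations of V only, and this
  lemma carries the bounds over to V.\<close>

lemma mean_le_truncated:
  assumes V: "\<And>x. 0 \<le> V x" and le: "\<And>k::nat. measure_pmf.expectation p (\<lambda>x. min (V x) (real k)) \<le> M"
  shows "mean_le p V M"
proof -
  have "ennreal (V x) = (SUP k. ennreal (min (V x) (real k)))" for x
  proof (rule antisym)
    obtain k :: nat where "V x \<le> real k" using real_arch_simple by blast
    then show "ennreal (V x) \<le> (SUP k. ennreal (min (V x) (real k)))" by (intro SUP_upper2[of k]) auto
  qed (auto intro!: SUP_least ennreal_leI)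
  then have "(\<integral>\<^sup>+x. ennreal (V x) \<partial>measure_pmf p) = (\<integral>\<^sup>+x. (SUP k. ennreal (min (V x) (real k))) \<partial>measure_pmf p)" by simp
  also have "\<dots> = (SUP k. \<integral>\<^sup>+x. ennreal (min (V x) (real k)) \<partial>measure_pmf p)"
    by (intro nn_integral_monotone_convergence_SUP) (auto simp: incseq_def le_fun_def intro!: ennreal_leI min.mono)
  also have "\<dots> \<le> ennreal M"
  proof (rule SUP_least)
    fix k :: nat
    have "\<bar>min (V x) (real k)\<bar> \<le> real k" for x using V[of x] by (simp add: min_def)
    then have "integrable (measure_pmf p) (\<lambda>x. min (V x) (real k))" by (rule integrable_pmf_bounded)
    from nn_integral_eq_integral[OF this] V le[of k]
    show "(\<integral>\<^sup>+x. ennreal (min (V x) (real k)) \<partial>measure_pmf p) \<le> ennreal M" by (auto intro!: ennreal_leI)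
  qed
  finally show ?thesis by (simp add: mean_le_def)
qed

text \<open>Fatou's lemma on counting measure. The pointwise limit \<open>l\<close> of the mass
  functions may have lost mass, so it cannot yet be treated as a pmf and only an inequality is
  available.\<close>

lemma nn_integral_pmf_Fatou:
  fixes p :: "nat \<Rightarrow> 'a pmf" and l :: "'a \<Rightarrow> real"
  assumes "\<And>y. (\<lambda>k. pmf (p k) y) \<longlonglongrightarrow> l y"
  shows "(\<integral>\<^sup>+y. ennreal (l y) * ennreal (F y) \<partial>count_space UNIV) \<le> liminf (\<lambda>k. \<integral>\<^sup>+y. ennreal (F y) \<partial>measure_pmf (p k))"
proof -
  have "ennreal (l y) * ennreal (F y) = liminf (\<lambda>k. ennreal (pmf (p k) y) * ennreal (F y))" for y
    using assms[of y] by (intro lim_imp_Liminf[symmetric]) (auto intro!: tendsto_mult_ennreal)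
  then have "(\<integral>\<^sup>+y. ennreal (l y) * ennreal (F y) \<partial>count_space UNIV)
      = (\<integral>\<^sup>+y. liminf (\<lambda>k. ennreal (pmf (p k) y) * ennreal (F y)) \<partial>count_space UNIV)" by simp
  also have "\<dots> \<le> liminf (\<lambda>k. \<integral>\<^sup>+y. ennreal (pmf (p k) y) * ennreal (F y) \<partial>count_space UNIV)"
    by (rule nn_integral_liminf) auto
  also have "\<dots> = liminf (\<lambda>k. \<integral>\<^sup>+y. ennreal (F y) \<partial>measure_pmf (p k))"
    by (simp add: nn_integral_measure_pmf)
  finally show ?thesis .
qed

text \<open>\<open>d\<close> dominates the indicator of disagreement, so \<open>M\<close> bounds the
  probability that the two components differ.\<close>

lemma coupling_inequality:
  assumes d: "\<And>u. 0 \<le> d u" "\<And>u v. u \<noteq> v \<Longrightarrow> 1 \<le> d (u, v)" and M: "0 \<le> M" "mean_le c d M"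
  shows "\<bar>measure (map_pmf fst c) B - measure (map_pmf snd c) B\<bar> \<le> M"
proof -
  let ?D = "{z. fst z \<noteq> snd z}"
  have D: "measure c ?D \<le> M"
  proof -
    have "measure c ?D = measure_pmf.expectation c (indicator ?D)" by simp
    also have "\<dots> \<le> measure_pmf.expectation c d"
      using d by (intro integral_mono mean_leD(1)[OF _ M] integrable_pmf_bounded[of _ 1]) (auto simp: indicator_def)
    also have "\<dots> \<le> M" using d by (intro mean_leD[OF _ M])
    finally show ?thesis .
  qed
  have 1: "measure c (fst -` B) \<le> measure c (snd -` B) + measure c ?D"
    by (rule order_trans[OF measure_pmf.finite_measure_mono measure_Un_le]) auto
  have 2: "measure c (snd -` B) \<le> measure c (fst -` B) + measure c ?D"
    by (rule order_trans[OF measure_pmf.finite_measure_mono measure_Un_le]) auto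
  from 1 2 D show ?thesis by (auto simp: abs_if)
qed

section \<open>Iterated kernels and the weighted distance\<close>

primrec kernel_power :: "('a \<Rightarrow> 'a pmf) \<Rightarrow> nat \<Rightarrow> 'a \<Rightarrow> 'a pmf" where
  "kernel_power Q 0 x = return_pmf x"
| "kernel_power Q (Suc n) x = bind_pmf (kernel_power Q n x) Q"

text \<open>The additive constants form the geometric series K + K/2 + K/4 + ..., bounded by
  \<open>2 * K\<close>.\<close>

lemma mean_le_kernel_power:
  assumes V: "\<And>x. 0 \<le> V x" and K: "0 \<le> K" and drift: "\<And>x. mean_le (Q x) V (V x / 2 + K)"
  shows "mean_le (kernel_power Q n x) V (V x / 2 ^ n + 2 * K)"
proof (induction n)
  case 0
  show ?case using K by (auto intro: mean_le_mono[OF mean_le_return])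
next
  case (Suc n)
  have "mean_le (kernel_power Q (Suc n) x) V (1/2 * (V x / 2 ^ n + 2 * K) + K)"
    unfolding kernel_power.simps using V K drift Suc by (intro mean_le_bind[of V]) auto
  then show ?case by (simp add: add_divide_distrib add.commute mult.commute)
qed

text \<open>The Hairer-Mattingly metric: its transport cost is the total variation norm with weight
  \<open>1 + \<beta> * V\<close>. The constant 2 is what meeting gains, the V-terms are what drift
  gains.\<close>

definition weighted_discrete :: "real \<Rightarrow> ('a \<Rightarrow> real) \<Rightarrow> 'a \<times> 'a \<Rightarrow> real" where
  "weighted_discrete \<beta> V u = (if fst u = snd u then 0 else 2 + \<beta> * V (fst u) + \<beta> * V (snd u))"

text \<open>
  The two copies move together once they have met and independently before. Away from the sublevel
  set the distance shrinks by the drift condition; on it, both copies jump to \<open>o'\<close> with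
  probability at least \<open>\<alpha>\<^sup>2\<close>, which for small \<open>\<beta>\<close> outweighs the constant in the drift condition.
\<close>

definition coupled_kernel :: "('a \<Rightarrow> 'a pmf) \<Rightarrow> 'a \<times> 'a \<Rightarrow> ('a \<times> 'a) pmf" where
  "coupled_kernel Q u = (if fst u = snd u then map_pmf (\<lambda>w. (w, w)) (Q (fst u))
     else pair_pmf (Q (fst u)) (Q (snd u)))"

lemma map_coupled_kernel:
  "map_pmf fst (coupled_kernel Q u) = Q (fst u)" "map_pmf snd (coupled_kernel Q u) = Q (snd u)"
  by (auto simp: coupled_kernel_def map_pmf_comp map_fst_pair_pmf map_snd_pair_pmf)

lemma weighted_discrete_nonneg: "0 \<le> \<beta> \<Longrightarrow> (\<And>x. 0 \<le> V x) \<Longrightarrow> 0 \<le> weighted_discrete \<beta> V u"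
  by (simp add: weighted_discrete_def)

lemma coupled_kernel_contraction:
  fixes V :: "'a \<Rightarrow> real"
  assumes V: "\<And>x. 0 \<le> V x" and K: "0 \<le> K" and drift: "\<And>x. mean_le (Q x) V (V x / 2 + K)"
    and \<alpha>: "0 < \<alpha>" "\<And>x. V x \<le> 8 * K + 1 \<Longrightarrow> \<alpha> \<le> pmf (Q x) o'"
  obtains \<beta> \<kappa> where "0 < \<beta>" "0 < \<kappa>" "\<kappa> < 1"
    "\<And>u. mean_le (coupled_kernel Q u) (weighted_discrete \<beta> V) (\<kappa> * weighted_discrete \<beta> V u)"
proof -
  \<comment> \<open>The two copies add \<open>2 * \<beta> * K\<close> through the drift constant;
    this choice keeps it at most \<open>\<alpha>\<^sup>2\<close>, half of the gain
    \<open>2 * \<alpha>\<^sup>2\<close> from meeting at \<open>o'\<close>.\<close>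
  define \<beta> where "\<beta> = \<alpha>\<^sup>2 / (2 * K + 1)"
  define \<eta> where "\<eta> = min (1/8) (min (\<beta> / 16) (\<alpha>\<^sup>2 / 2))"
  have \<beta>: "0 < \<beta>" using \<alpha> K by (simp add: \<beta>_def)
  have \<beta>K: "2 * \<beta> * K \<le> \<alpha>\<^sup>2"
  proof -
    have "\<alpha>\<^sup>2 = \<beta> * (2 * K + 1)" using K by (simp add: \<beta>_def)
    then show ?thesis using \<beta> by (simp add: algebra_simps)
  qed
  have \<eta>: "0 < \<eta>" "\<eta> \<le> 1/8" "\<eta> \<le> \<beta> / 16" "\<eta> \<le> \<alpha>\<^sup>2 / 2" using \<alpha> \<beta> by (auto simp: \<eta>_def)
  have "mean_le (coupled_kernel Q u) (weighted_discrete \<beta> V) ((1 - \<eta>) * weighted_discrete \<beta> V u)" for u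
  proof (cases "fst u = snd u")
    case True
    then show ?thesis by (simp add: mean_le_def coupled_kernel_def weighted_discrete_def)
  next
    case False
    define x y where "x = fst u" and "y = snd u"
    define c where "c = pair_pmf (Q x) (Q y)"
    let ?a = "pmf (Q x) o' * pmf (Q y) o'"
    \<comment> \<open>A majorant of the distance with explicit mean: of all diagonal pairs, only
      \<open>(o', o')\<close> is exempted from the constant 2.\<close>
    let ?g = "\<lambda>u. 2 * indicator (- {(o', o')}) u + \<beta> * V (fst u) + \<beta> * V (snd u)"
    have xy: "mean_le (Q w) V (V w / 2 + K)" "0 \<le> V w / 2 + K" for w using drift V[of w] K by auto
    have intV: "integrable (Q w) V" and EV: "measure_pmf.expectation (Q w) V \<le> V w / 2 + K" for w
      using mean_leD[OF V xy(2) xy(1)] by auto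
    have i1: "integrable c (\<lambda>u. V (fst u))" 
      using intV[of x] by (subst integrable_map_pmf_eq[symmetric]) (simp add: c_def map_fst_pair_pmf)
    have i2: "integrable c (\<lambda>u. V (snd u))" 
      using intV[of y] by (subst integrable_map_pmf_eq[symmetric]) (simp add: c_def map_snd_pair_pmf)
    have i3: "integrable c (\<lambda>u. indicator (- {(o', o')}) u :: real)"
      by (intro integrable_pmf_bounded[of _ 1]) (auto simp: indicator_def)
    have ig: "integrable c ?g" using i1 i2 i3 by simp
    have id: "integrable c (weighted_discrete \<beta> V)"
      using \<beta> V by (intro Bochner_Integration.integrable_bound[OF ig])
        (auto simp: weighted_discrete_def indicator_def split: if_splits)
    have "measure_pmf.expectation c (weighted_discrete \<beta> V) \<le> measure_pmf.expectation c ?g"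
      using \<beta> V by (intro integral_mono id ig) (auto simp: weighted_discrete_def indicator_def)
    also have "\<dots> = 2 * measure c (- {(o', o')}) + \<beta> * measure_pmf.expectation (Q x) V + \<beta> * measure_pmf.expectation (Q y) V"
      using i1 i2 i3 by (simp add: c_def)
    also have "measure c (- {(o', o')}) = 1 - ?a"
      using measure_pmf.prob_compl[of "{(o', o')}" c] by (simp add: Compl_eq_Diff_UNIV measure_pmf_single pmf_pair c_def)
    finally have E: "measure_pmf.expectation c (weighted_discrete \<beta> V) \<le> 2 * (1 - ?a) + \<beta> * (V x + V y) / 2 + 2 * \<beta> * K"
      using mult_left_mono[OF EV[of x] less_imp_le[OF \<beta>]] mult_left_mono[OF EV[of y] less_imp_le[OF \<beta>]]
      by (simp add: algebra_simps add_divide_distrib)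
    define S where "S = V x + V y"
    have S: "0 \<le> S" using V[of x] V[of y] by (simp add: S_def)
    \<comment> \<open>Beyond the threshold \<open>8 * K + 1\<close>, the half of
      \<open>\<beta> * S\<close> removed by the drift absorbs \<open>2 * \<beta> * K\<close> and
      every term with \<open>\<eta>\<close>; in \<open>near\<close> the meeting probability does
      this.\<close>
    have far: "2 * (1 - A) + P / 2 + 2 * L \<le> 2 + P - 2 * \<eta> - E"
      if "0 \<le> A" "8 * L + \<beta> \<le> P" "E \<le> 1/8 * P" "0 \<le> L" for A P L E :: real
    proof -
      have "0 \<le> P" using that \<beta> by linarith
      then show ?thesis using that \<eta>(3) \<beta> by (simp add: field_simps)
    qed
    have near: "2 * (1 - A) + P / 2 + 2 * L \<le> 2 + P - 2 * \<eta> - E"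
      if "\<alpha>\<^sup>2 \<le> A" "E \<le> 1/2 * P" "2 * L \<le> \<alpha>\<^sup>2" for A P L E :: real
      using that \<eta>(4) by (simp add: field_simps)
    have eq: "(1 - \<eta>) * (2 + \<beta> * S) = 2 + \<beta> * S - 2 * \<eta> - \<eta> * (\<beta> * S)" by (simp add: algebra_simps)
    have "2 * (1 - ?a) + \<beta> * S / 2 + 2 * \<beta> * K \<le> (1 - \<eta>) * (2 + \<beta> * S)"
    proof (cases "S \<ge> 8 * K + 1")
      case True
      have "0 \<le> ?a" by simp
      moreover have "\<beta> * (8 * K + 1) \<le> \<beta> * S" using True \<beta> by (intro mult_left_mono) auto
      then have "8 * (\<beta> * K) + \<beta> \<le> \<beta> * S" by (simp add: algebra_simps)
      moreover have "\<eta> * (\<beta> * S) \<le> 1/8 * (\<beta> * S)" using \<eta> \<beta> S by (intro mult_right_mono) auto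
      moreover have "0 \<le> \<beta> * K" using \<beta> K by simp
      ultimately show ?thesis unfolding eq mult.assoc[of 2] by (intro far)
    next
      case False
      then have "\<alpha> \<le> pmf (Q x) o'" "\<alpha> \<le> pmf (Q y) o'" using V[of x] V[of y] by (auto simp: S_def intro!: \<alpha>)
      then have "\<alpha>\<^sup>2 \<le> ?a" using \<alpha> by (auto simp: power2_eq_square intro!: mult_mono)
      moreover have "\<eta> * (\<beta> * S) \<le> 1/2 * (\<beta> * S)" using \<eta> \<beta> S by (intro mult_right_mono) auto
      ultimately show ?thesis using \<beta>K unfolding eq mult.assoc[of 2] by (intro near)
    qed
    with E have "measure_pmf.expectation c (weighted_discrete \<beta> V) \<le> (1 - \<eta>) * (2 + \<beta> * S)" by (simp add: S_def)
    also have "2 + \<beta> * S = weighted_discrete \<beta> V u"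
      using False by (simp add: weighted_discrete_def S_def x_def y_def algebra_simps)
    finally have "mean_le c (weighted_discrete \<beta> V) ((1 - \<eta>) * weighted_discrete \<beta> V u)"
      using \<beta> V id by (intro mean_leI) (auto intro: weighted_discrete_nonneg)
    then show ?thesis using False by (simp add: coupled_kernel_def c_def x_def y_def)
  qed
  then show ?thesis using \<beta> \<eta> by (intro that[of \<beta> "1 - \<eta>"]) auto
qed

text \<open>\<open>coupled_kernel\<close> is iterated from the independent coupling of
  \<open>p\<close> and \<open>q\<close>. The marginals remain the two laws to be compared, the mean
  distance shrinks by \<open>\<kappa>\<close> at each step, and the coupling inequality turns it
  into a bound on sets.\<close>

lemma kernel_power_contraction:
  fixes V :: "'a \<Rightarrow> real"
  assumes V: "\<And>x. 0 \<le> V x" and K: "0 \<le> K" and drift: "\<And>x. mean_le (Q x) V (V x / 2 + K)"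
    and \<alpha>: "0 < \<alpha>" "\<And>x. V x \<le> 8 * K + 1 \<Longrightarrow> \<alpha> \<le> pmf (Q x) o'"
  obtains \<beta> \<kappa> where "0 < \<beta>" "0 < \<kappa>" "\<kappa> < 1"
    "\<And>n p q a b B. 0 \<le> a \<Longrightarrow> 0 \<le> b \<Longrightarrow> mean_le p V a \<Longrightarrow> mean_le q V b \<Longrightarrow>
       \<bar>measure (bind_pmf p (kernel_power Q n)) B - measure (bind_pmf q (kernel_power Q n)) B\<bar>
         \<le> \<kappa> ^ n * (2 + \<beta> * a + \<beta> * b)"
proof -
  obtain \<beta> \<kappa> where \<beta>: "0 < \<beta>" and \<kappa>: "0 < \<kappa>" "\<kappa> < 1"
    and contr: "\<And>u. mean_le (coupled_kernel Q u) (weighted_discrete \<beta> V) (\<kappa> * weighted_discrete \<beta> V u)"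
    using coupled_kernel_contraction[of V K Q \<alpha> o', OF V K drift \<alpha>] by metis
  let ?d = "weighted_discrete \<beta> V"
  have d0: "0 \<le> ?d u" for u using \<beta> V by (intro weighted_discrete_nonneg) auto
  have d1: "1 \<le> ?d (u, v)" if "u \<noteq> v" for u v using that \<beta> V[of u] V[of v] by (simp add: weighted_discrete_def)
  have "\<bar>measure (bind_pmf p (kernel_power Q n)) B - measure (bind_pmf q (kernel_power Q n)) B\<bar>
         \<le> \<kappa> ^ n * (2 + \<beta> * a + \<beta> * b)"
    if a: "0 \<le> a" "mean_le p V a" and b: "0 \<le> b" "mean_le q V b" for n p q a b B
  proof -
    define c where "c n = rec_nat (pair_pmf p q) (\<lambda>_ c. bind_pmf c (coupled_kernel Q)) n" for n
    have c_simps: "c 0 = pair_pmf p q" "c (Suc n) = bind_pmf (c n) (coupled_kernel Q)" for n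
      by (simp_all add: c_def)
    have fst: "map_pmf fst (c n) = bind_pmf p (kernel_power Q n)" for n
    proof (induction n)
      case 0
      show ?case by (simp add: c_simps map_fst_pair_pmf bind_return_pmf')
    next
      case (Suc n)
      have "map_pmf fst (c (Suc n)) = bind_pmf (map_pmf fst (c n)) Q"
        by (simp add: c_simps map_bind_pmf map_coupled_kernel bind_map_pmf)
      then show ?case by (simp add: Suc bind_assoc_pmf)
    qed
    have snd: "map_pmf snd (c n) = bind_pmf q (kernel_power Q n)" for n
    proof (induction n)
      case 0
      show ?case by (simp add: c_simps map_snd_pair_pmf bind_return_pmf')
    next
      case (Suc n)
      have "map_pmf snd (c (Suc n)) = bind_pmf (map_pmf snd (c n)) Q"
        by (simp add: c_simps map_bind_pmf map_coupled_kernel bind_map_pmf)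
      then show ?case by (simp add: Suc bind_assoc_pmf)
    qed
    have nonneg: "0 \<le> 2 + \<beta> * a + \<beta> * b" using a b \<beta> by simp
    have mean: "mean_le (c n) ?d (\<kappa> ^ n * (2 + \<beta> * a + \<beta> * b))" for n
    proof (induction n)
      case 0
      note ia = mean_leD[OF V a] and ib = mean_leD[OF V b]
      have i1: "integrable (c 0) (\<lambda>u. V (fst u))" 
        using ia by (subst integrable_map_pmf_eq[symmetric]) (simp add: c_simps map_fst_pair_pmf)
      have i2: "integrable (c 0) (\<lambda>u. V (snd u))" 
        using ib by (subst integrable_map_pmf_eq[symmetric]) (simp add: c_simps map_snd_pair_pmf)
      let ?g = "\<lambda>u. 2 + \<beta> * V (fst u) + \<beta> * V (snd u)"
      have ig: "integrable (c 0) ?g" using i1 i2 by simp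
      have id: "integrable (c 0) ?d"
        using \<beta> V by (intro Bochner_Integration.integrable_bound[OF ig]) (auto simp: weighted_discrete_def)
      have "measure_pmf.expectation (c 0) ?d \<le> measure_pmf.expectation (c 0) ?g"
        using \<beta> V by (intro integral_mono id ig) (auto simp: weighted_discrete_def)
      also have "\<dots> = 2 + \<beta> * measure_pmf.expectation p V + \<beta> * measure_pmf.expectation q V"
        using i1 i2 by (simp add: c_simps)
      also have "\<dots> \<le> 2 + \<beta> * a + \<beta> * b" using ia ib \<beta> by (intro add_mono mult_left_mono) auto
      finally show ?case using d0 id by (auto intro!: mean_leI)
    next
      case (Suc n)
      have "mean_le (bind_pmf (c n) (coupled_kernel Q)) ?d (\<kappa> * (\<kappa> ^ n * (2 + \<beta> * a + \<beta> * b)) + 0)"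
        using Suc d0 \<kappa> nonneg contr by (intro mean_le_bind[of ?d]) auto
      then show ?case by (simp add: c_simps mult.assoc)
    qed
    show ?thesis
      using coupling_inequality[of ?d, OF d0 d1 _ mean[of n], of B] nonneg \<kappa> by (simp add: fst snd del: measure_map_pmf)
  qed
  with \<beta> \<kappa> show ?thesis by (intro that[of \<beta> \<kappa>])
qed

section \<open>Jump semigroups with a Lyapunov function\<close>

definition jump_generator ::
  "'j set \<Rightarrow> ('j \<Rightarrow> 's \<Rightarrow> real) \<Rightarrow> ('j \<Rightarrow> 's \<Rightarrow> 's) \<Rightarrow> ('s \<Rightarrow> real) \<Rightarrow> 's \<Rightarrow> real" where
  "jump_generator J r \<tau> f x = (\<Sum>j\<in>J. r j x * (f (\<tau> j x) - f x))"

text \<open>The semigroup is seen only through Dynkin's formula for finitely supported functions;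
  continuity and integrability in time have to be derived from it. \<open>finite_vimage\<close>
  takes the place of bounded rates.\<close>

locale jump_semigroup =
  fixes p :: "real \<Rightarrow> 's \<Rightarrow> 's pmf" and J :: "'j set"
    and r :: "'j \<Rightarrow> 's \<Rightarrow> real" and \<tau> :: "'j \<Rightarrow> 's \<Rightarrow> 's"
  assumes finite_J: "finite J" and rate_nonneg: "\<And>j x. j \<in> J \<Longrightarrow> 0 \<le> r j x"
    and finite_vimage: "\<And>j y. j \<in> J \<Longrightarrow> finite (\<tau> j -` {y})"
    and p_0: "\<And>x. p 0 x = return_pmf x"
    and p_add: "\<And>s t x. 0 \<le> s \<Longrightarrow> 0 \<le> t \<Longrightarrow> p (s + t) x = bind_pmf (p s x) (p t)"
    and dynkin: "\<And>f t x. finite {y. f y \<noteq> 0} \<Longrightarrow> 0 \<le> t \<Longrightarrow>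
       measure_pmf.expectation (p t x) f
         = f x + (LINT s:{0..t}|lborel. measure_pmf.expectation (p s x) (jump_generator J r \<tau> f))"
begin

abbreviation "gen \<equiv> jump_generator J r \<tau>"

definition "exit_rate x = (\<Sum>j\<in>J. r j x)"

lemma exit_rate_nonneg: "0 \<le> exit_rate x"
  by (auto simp: exit_rate_def intro!: sum_nonneg rate_nonneg)

text \<open>\<open>gen f\<close> vanishes off the support of \<open>f\<close> and its preimages
  under the jumps, which form a finite set.\<close>

lemma gen_bounded:
  assumes "finite {y. f y \<noteq> 0}"
  obtains b where "\<And>x. \<bar>gen f x\<bar> \<le> b"
proof -
  let ?F = "{y. f y \<noteq> 0} \<union> (\<Union>j\<in>J. \<Union>y\<in>{y. f y \<noteq> 0}. \<tau> j -` {y})"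
  have fin: "finite ?F" using assms finite_J finite_vimage by auto
  have "\<bar>gen f x\<bar> \<le> (\<Sum>x\<in>?F. \<bar>gen f x\<bar>)" for x
  proof (cases "x \<in> ?F")
    case True
    then show ?thesis using fin by (intro member_le_sum) auto
  next
    case False
    then have "f x = 0" "\<And>j. j \<in> J \<Longrightarrow> f (\<tau> j x) = 0" by auto
    then have "gen f x = 0" by (simp add: jump_generator_def)
    then show ?thesis by (simp add: sum_nonneg)
  qed
  then show ?thesis by (rule that)
qed

text \<open>Dynkin's formula for the indicator of \<open>x\<close>: inflow only helps, so its
  generator image is at least \<open>- exit_rate x\<close> everywhere.\<close>

lemma holding_probability:
  assumes "0 \<le> t"
  shows "1 - exit_rate x * t \<le> pmf (p t x) x"
proof -
  let ?f = "indicator {x} :: 's \<Rightarrow> real"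
  have fin: "finite {y. ?f y \<noteq> 0}" by (rule finite_subset[of _ "{x}"]) (auto simp: indicator_def)
  obtain b where b: "\<And>y. \<bar>gen ?f y\<bar> \<le> b" using gen_bounded[OF fin] by blast
  have low: "- exit_rate x \<le> gen ?f y" for y
  proof (cases "y = x")
    case True
    have "- exit_rate x = (\<Sum>j\<in>J. r j x * (0 - 1))" by (simp add: exit_rate_def sum_negf)
    also have "\<dots> \<le> gen ?f x"
      unfolding jump_generator_def by (intro sum_mono mult_left_mono rate_nonneg) auto
    finally show ?thesis using True by simp
  next
    case False
    then have "0 \<le> gen ?f y"
      unfolding jump_generator_def by (intro sum_nonneg mult_nonneg_nonneg rate_nonneg) auto
    then show ?thesis using exit_rate_nonneg[of x] by linarith
  qed
  let ?e = "\<lambda>s. measure_pmf.expectation (p s x) (gen ?f)"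
  have e: "- exit_rate x \<le> ?e s" for s
  proof -
    have "measure_pmf.expectation (p s x) (\<lambda>_. - exit_rate x) \<le> ?e s"
      using low by (intro integral_mono integrable_pmf_bounded[OF b]) auto
    then show ?thesis by simp
  qed
  have "- exit_rate x * t \<le> (LINT s:{0..t}|lborel. ?e s)"
  proof (cases "set_integrable lborel {0..t} ?e")
    case True
    have "(LINT s:{0..t}|lborel. - exit_rate x) \<le> (LINT s:{0..t}|lborel. ?e s)"
      using e by (intro set_integral_mono True borel_integrable_atLeastAtMost' continuous_on_const) auto
    then show ?thesis using assms by (simp add: set_lebesgue_integral_def mult.commute)
  next
    case False
    \<comment> \<open>Measurability in \<open>s\<close> only follows from this lemma; until then the integral may be the junk value \<open>0\<close>.\<close>
    then have "(LINT s:{0..t}|lborel. ?e s) = 0"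
      unfolding set_integrable_def set_lebesgue_integral_def by (rule not_integrable_integral_eq)
    then show ?thesis using assms exit_rate_nonneg[of x] by simp
  qed
  then show ?thesis using dynkin[OF fin assms, of x] by (simp add: measure_pmf_single)
qed

text \<open>The extra time \<open>s\<close> is put first. Then \<open>F\<close> differs from
  \<open>F x\<close> only if the process is away from \<open>x\<close> at time \<open>s\<close>,
  which has probability at most \<open>exit_rate x * s\<close>; hence the constant does not depend
  on \<open>t\<close>.\<close>

lemma expectation_Lipschitz:
  fixes f :: "'s \<Rightarrow> real"
  assumes f: "\<And>y. \<bar>f y\<bar> \<le> b" and st: "0 \<le> s" "0 \<le> t"
  shows "\<bar>measure_pmf.expectation (p (s + t) x) f - measure_pmf.expectation (p t x) f\<bar> \<le> 2 * b * exit_rate x * s"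
proof -
  define F where "F y = measure_pmf.expectation (p t y) f" for y
  have F: "\<bar>F y\<bar> \<le> b" for y unfolding F_def by (rule expectation_bounded[OF f])
  have b: "0 \<le> b" using f[of x] by simp
  have int: "integrable (p s x) F" by (rule integrable_pmf_bounded[OF F])
  have "measure_pmf.expectation (p (s + t) x) f - F x = measure_pmf.expectation (p s x) (\<lambda>y. F y - F x)"
    using int by (simp add: p_add[OF st] expectation_bind_bounded[OF f] flip: F_def)
  moreover have "\<bar>measure_pmf.expectation (p s x) (\<lambda>y. F y - F x)\<bar> \<le> measure_pmf.expectation (p s x) (\<lambda>y. \<bar>F y - F x\<bar>)"
    by (rule integral_abs_bound)
  moreover have "measure_pmf.expectation (p s x) (\<lambda>y. \<bar>F y - F x\<bar>) \<le> measure_pmf.expectation (p s x) (\<lambda>y. 2 * b * indicator (- {x}) y)"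
  proof (intro integral_mono)
    show "integrable (p s x) (\<lambda>y. \<bar>F y - F x\<bar>)" using int by simp
    show "integrable (p s x) (\<lambda>y. 2 * b * indicator (- {x}) y :: real)"
      using b by (intro integrable_pmf_bounded[of _ "2 * b"]) (auto simp: indicator_def)
    show "\<bar>F y - F x\<bar> \<le> 2 * b * indicator (- {x}) y" for y
      using F[of y] F[of x] by (auto simp: indicator_def)
  qed
  moreover have "measure_pmf.expectation (p s x) (\<lambda>y. 2 * b * indicator (- {x}) y) = 2 * b * (1 - pmf (p s x) x)"
    using measure_pmf.prob_compl[of "{x}" "p s x"] by (simp add: Compl_eq_Diff_UNIV measure_pmf_single)
  moreover have "2 * b * (1 - pmf (p s x) x) \<le> 2 * b * (exit_rate x * s)"
    using holding_probability[OF st(1), of x] b by (intro mult_left_mono) auto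
  ultimately show ?thesis unfolding F_def mult.assoc by linarith
qed

lemma expectation_continuous:
  fixes f :: "'s \<Rightarrow> real"
  assumes f: "\<And>y. \<bar>f y\<bar> \<le> b"
  shows "continuous_on {0..} (\<lambda>t. measure_pmf.expectation (p t x) f)"
proof -
  have b: "0 \<le> b" using f[of x] by simp
  have *: "\<bar>measure_pmf.expectation (p t x) f - measure_pmf.expectation (p s x) f\<bar> \<le> 2 * b * exit_rate x * (t - s)"
    if "0 \<le> s" "s \<le> t" for s t
    using expectation_Lipschitz[OF f, of "t - s" s x] that by simp
  have "(2 * b * exit_rate x)-lipschitz_on {0..} (\<lambda>t. measure_pmf.expectation (p t x) f)"
  proof (rule lipschitz_onI)
    fix s t :: real assume "s \<in> {0..}" "t \<in> {0..}"
    then show "dist (measure_pmf.expectation (p s x) f) (measure_pmf.expectation (p t x) f) \<le> 2 * b * exit_rate x * dist s t"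
      using *[of s t] *[of t s] by (cases "s \<le> t") (auto simp: dist_real_def abs_minus_commute)
  qed (use b exit_rate_nonneg in auto)
  then show ?thesis by (rule lipschitz_on_continuous_on)
qed

lemma set_integrable_expectation:
  fixes f :: "'s \<Rightarrow> real"
  assumes f: "\<And>y. \<bar>f y\<bar> \<le> b"
  shows "set_integrable lborel {0..t} (\<lambda>s. measure_pmf.expectation (p s x) f)"
  by (intro borel_integrable_atLeastAtMost' continuous_on_subset[OF expectation_continuous[OF f]]) auto

section \<open>Positivity of transition probabilities\<close>

lemma pmf_add_ge:
  assumes "0 \<le> s" "0 \<le> t"
  shows "pmf (p s x) y * pmf (p t y) z \<le> pmf (p (s + t) x) z"
proof -
  have "pmf (p s x) y * pmf (p t y) z = measure_pmf.expectation (p s x) (\<lambda>w. indicator {y} w * pmf (p t y) z)"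
    by (simp add: measure_pmf_single)
  also have "\<dots> \<le> measure_pmf.expectation (p s x) (\<lambda>w. pmf (p t w) z)"
    by (intro integral_mono integrable_pmf_bounded[of _ 1]) (auto simp: indicator_def pmf_le_1)
  finally show ?thesis by (simp add: p_add[OF assms] pmf_bind)
qed

text \<open>The holding bound is positive for short times only, so \<open>t\<close> is cut into
  \<open>n\<close> equal pieces that are short enough.\<close>

lemma pmf_self_pos:
  assumes "0 \<le> t"
  shows "0 < pmf (p t x) x"
proof -
  obtain n :: nat where n: "exit_rate x * t < real n" using reals_Archimedean2 by blast
  moreover have "0 \<le> exit_rate x * t" using assms exit_rate_nonneg by simp
  ultimately have "0 < n" by linarith
  define s where "s = t / real n"
  have s: "0 \<le> s" "real n * s = t" using assms \<open>0 < n\<close> by (auto simp: s_def)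
  have "exit_rate x * s < 1" using n \<open>0 < n\<close> by (simp add: s_def)
  then have pos: "0 < pmf (p s x) x" using holding_probability[OF s(1), of x] by linarith
  have "0 < pmf (p (real k * s) x) x" for k
  proof (induction k)
    case 0
    show ?case by (simp add: p_0)
  next
    case (Suc k)
    have "0 < pmf (p (real k * s) x) x * pmf (p s x) x" using Suc pos by simp
    also have "\<dots> \<le> pmf (p (real k * s + s) x) x" using s by (intro pmf_add_ge) auto
    finally show ?case by (simp add: algebra_simps)
  qed
  from this[of n] show ?thesis by (simp add: s)
qed

text \<open>Dynkin's formula for the indicator of the target \<open>y\<close>: at early times the
  inflow from \<open>x\<close> outweighs the outflow from \<open>y\<close>, whose probability is
  still small. The remaining time \<open>t - s\<close> is passed from \<open>x\<close> to
  \<open>x\<close>.\<close>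

lemma jump_pos:
  assumes j: "j \<in> J" "0 < r j x" "\<tau> j x \<noteq> x" and t: "0 < t"
  shows "0 < pmf (p t x) (\<tau> j x)"
proof -
  define y where "y = \<tau> j x"
  \<comment> \<open>\<open>q * u\<close> is the total loss at time \<open>u\<close> from having left
    \<open>x\<close> and from leaving \<open>y\<close>. The time \<open>s\<close> keeps it at most
    \<open>r j x / 2\<close>; the 1 in \<open>q + 1\<close> covers \<open>q = 0\<close>.\<close>
  define q where "q = (r j x + exit_rate y) * exit_rate x"
  define s where "s = min t (r j x / (2 * (q + 1)))"
  have q: "0 \<le> q" using j exit_rate_nonneg by (simp add: q_def)
  have s: "0 < s" "s \<le> t" using j t q by (auto simp: s_def)
  have qs: "q * u \<le> r j x / 2" if "0 \<le> u" "u \<le> s" for u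
  proof -
    have "q * u \<le> (q + 1) * (r j x / (2 * (q + 1)))" using that q by (intro mult_mono) (auto simp: s_def)
    also have "\<dots> = r j x / 2" using q by (simp add: field_simps)
    finally show ?thesis .
  qed
  let ?f = "indicator {y} :: 's \<Rightarrow> real"
  have fin: "finite {w. ?f w \<noteq> 0}" by (rule finite_subset[of _ "{y}"]) (auto simp: indicator_def)
  obtain b where b: "\<And>w. \<bar>gen ?f w\<bar> \<le> b" using gen_bounded[OF fin] by blast
  have low: "r j x * indicator {x} w - exit_rate y * indicator {y} w \<le> gen ?f w" for w
  proof -
    consider "w = x" | "w = y" | "w \<noteq> x" "w \<noteq> y" by blast
    then show ?thesis
    proof cases
      case 1
      have "r j x * ?f (\<tau> j x) \<le> (\<Sum>j\<in>J. r j x * ?f (\<tau> j x))"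
        using j finite_J by (intro member_le_sum[of j]) (auto intro!: mult_nonneg_nonneg rate_nonneg)
      then show ?thesis using 1 j by (simp add: jump_generator_def y_def)
    next
      case 2
      have "- exit_rate y = (\<Sum>j\<in>J. r j y * (0 - 1))" by (simp add: exit_rate_def sum_negf)
      also have "\<dots> \<le> gen ?f y"
        unfolding jump_generator_def by (intro sum_mono mult_left_mono rate_nonneg) auto
      finally show ?thesis using 2 j by (simp add: y_def)
    next
      case 3
      then have "0 \<le> gen ?f w"
        unfolding jump_generator_def by (intro sum_nonneg mult_nonneg_nonneg rate_nonneg) auto
      then show ?thesis using 3 by simp
    qed
  qed
  have ind: "integrable (measure_pmf \<pi>) (indicat_real A)" for \<pi> :: "'s pmf" and A
    by (rule integrable_pmf_bounded[of _ 1]) (simp add: indicator_def)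
  have e: "r j x / 2 \<le> measure_pmf.expectation (p u x) (gen ?f)" if u: "0 \<le> u" "u \<le> s" for u
  proof -
    have xx: "1 - exit_rate x * u \<le> pmf (p u x) x" by (rule holding_probability[OF u(1)])
    have "measure (p u x) {x, y} = pmf (p u x) x + pmf (p u x) y"
      using j by (simp add: measure_measure_pmf_finite y_def)
    then have xy: "pmf (p u x) y \<le> exit_rate x * u"
      using xx measure_pmf.prob_le_1[of "p u x" "{x, y}"] by linarith
    have "r j x / 2 \<le> r j x - q * u" using qs[OF u] by simp
    also have "\<dots> = r j x * (1 - exit_rate x * u) - exit_rate y * (exit_rate x * u)" by (simp add: q_def algebra_simps)
    also have "\<dots> \<le> r j x * pmf (p u x) x - exit_rate y * pmf (p u x) y"
      using xx xy j exit_rate_nonneg[of y] by (intro diff_mono mult_left_mono) auto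
    also have "\<dots> = measure_pmf.expectation (p u x) (\<lambda>w. r j x * indicator {x} w - exit_rate y * indicator {y} w)"
      using ind by (subst Bochner_Integration.integral_diff) (auto simp: measure_pmf_single)
    also have "\<dots> \<le> measure_pmf.expectation (p u x) (gen ?f)"
      using ind by (intro integral_mono low integrable_pmf_bounded[OF b]) auto
    finally show ?thesis .
  qed
  have "(LINT u:{0..s}|lborel. r j x / 2) \<le> (LINT u:{0..s}|lborel. measure_pmf.expectation (p u x) (gen ?f))"
    using e
    by (intro set_integral_mono set_integrable_expectation[OF b] borel_integrable_atLeastAtMost' continuous_on_const) auto
  then have "s * (r j x / 2) \<le> pmf (p s x) y"
    using dynkin[OF fin less_imp_le[OF s(1)], of x] s j by (simp add: set_lebesgue_integral_def measure_pmf_single y_def)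
  then have "0 < pmf (p s x) y" using s j by (smt (verit) divide_pos_pos mult_pos_pos)
  then have "0 < pmf (p (t - s) x) x * pmf (p s x) y" using pmf_self_pos[of "t - s" x] s by simp
  also have "\<dots> \<le> pmf (p (t - s + s) x) y" using s by (intro pmf_add_ge) auto
  finally show ?thesis by (simp add: y_def)
qed

lemma reachable_pos:
  fixes m :: "'s \<Rightarrow> nat"
  assumes step: "\<And>x. x \<noteq> o' \<Longrightarrow> \<exists>j\<in>J. 0 < r j x \<and> m (\<tau> j x) < m x"
  shows "0 < t \<Longrightarrow> 0 < pmf (p t x) o'"
proof (induction "m x" arbitrary: x t rule: less_induct)
  case less
  show ?case
  proof (cases "x = o'")
    case True
    then show ?thesis using less.prems pmf_self_pos by simp
  next
    case False
    then obtain j where j: "j \<in> J" "0 < r j x" "m (\<tau> j x) < m x" using step by blast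
    have "0 < pmf (p (t / 2) x) (\<tau> j x) * pmf (p (t / 2) (\<tau> j x)) o'"
      using j less by (intro mult_pos_pos jump_pos) auto
    also have "\<dots> \<le> pmf (p (t / 2 + t / 2) x) o'" using less.prems by (intro pmf_add_ge) auto
    finally show ?thesis by simp
  qed
qed

end

locale jump_semigroup_drift = jump_semigroup p J r \<tau>
  for p :: "real \<Rightarrow> 's \<Rightarrow> 's pmf" and J :: "'j set"
    and r :: "'j \<Rightarrow> 's \<Rightarrow> real" and \<tau> :: "'j \<Rightarrow> 's \<Rightarrow> 's" +
  fixes V :: "'s \<Rightarrow> real" and C c :: real
  assumes V_nonneg: "\<And>x. 0 \<le> V x" and finite_sublevel: "\<And>K. finite {x. V x \<le> K}"
    and C_nonneg: "0 \<le> C" and c_pos: "0 < c"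
    and drift: "\<And>x. jump_generator J r \<tau> V x \<le> C - c * V x"
begin

section \<open>Moment bounds for V along the semigroup\<close>

lemma truncated_bounds: "0 \<le> K \<Longrightarrow> \<bar>min (V x) K\<bar> \<le> K" "0 \<le> K \<Longrightarrow> \<bar>V x * indicator {y. V y < K} x\<bar> \<le> K"
  using V_nonneg[of x] by (auto simp: min_def indicator_def)

text \<open>Where \<open>V < K\<close>, the function \<open>min V K - K\<close> agrees with
  \<open>V - K\<close> at the state and is at most \<open>V - K\<close> after a jump, so it inherits
  the drift of V. Where \<open>V \<ge> K\<close> it is at its maximum 0, so its generator image is
  nonpositive. The term with \<open>c\<close> thus survives only on \<open>V < K\<close>.\<close>

lemma expectation_truncated_le:
  assumes K: "0 \<le> K" and t: "0 \<le> t"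
  shows "measure_pmf.expectation (p t x) (\<lambda>y. min (V y) K)
       + c * (LINT s:{0..t}|lborel. measure_pmf.expectation (p s x) (\<lambda>y. V y * indicator {y. V y < K} y))
     \<le> V x + C * t"
proof -
  define f where "f y = min (V y) K - K" for y
  define u where "u y = V y * indicator {y. V y < K} y" for y
  have u: "\<bar>u y\<bar> \<le> K" for y unfolding u_def by (rule truncated_bounds[OF K])
  have fin: "finite {y. f y \<noteq> 0}"
    by (rule finite_subset[OF _ finite_sublevel[of K]]) (auto simp: f_def min_def)
  obtain b where b: "\<And>y. \<bar>gen f y\<bar> \<le> b" using gen_bounded[OF fin] by blast
  have gen_le: "gen f y \<le> C - c * u y" for y
  proof (cases "V y < K")
    case True
    have "gen f y \<le> gen V y"
      unfolding jump_generator_def using True by (intro sum_mono mult_left_mono rate_nonneg) (auto simp: f_def)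
    then show ?thesis using drift[of y] True by (simp add: u_def)
  next
    case False
    have "gen f y \<le> (\<Sum>j\<in>J. 0)"
      unfolding jump_generator_def using False by (intro sum_mono mult_nonneg_nonpos rate_nonneg) (auto simp: f_def)
    then show ?thesis using C_nonneg False by (simp add: u_def)
  qed
  have e: "measure_pmf.expectation (p s x) (gen f) \<le> C - c * measure_pmf.expectation (p s x) u" for s
  proof -
    have iu: "integrable (p s x) u" by (rule integrable_pmf_bounded[OF u])
    have "measure_pmf.expectation (p s x) (gen f) \<le> measure_pmf.expectation (p s x) (\<lambda>y. C - c * u y)"
      using iu by (intro integral_mono integrable_pmf_bounded[OF b] gen_le) auto
    then show ?thesis using iu by simp
  qed
  let ?U = "\<lambda>s. measure_pmf.expectation (p s x) u"
  have iU: "set_integrable lborel {0..t} ?U" by (rule set_integrable_expectation[OF u])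
  have iC: "set_integrable lborel {0..t} (\<lambda>_. C)" by (intro borel_integrable_atLeastAtMost' continuous_on_const)
  have "(LINT s:{0..t}|lborel. measure_pmf.expectation (p s x) (gen f)) \<le> (LINT s:{0..t}|lborel. C - c * ?U s)"
    using e iU iC by (intro set_integral_mono set_integrable_expectation[OF b] set_integral_diff) auto
  also have "\<dots> = (LINT s:{0..t}|lborel. C) - c * (LINT s:{0..t}|lborel. ?U s)"
    using iU iC by simp
  also have "(LINT s:{0..t}|lborel. C) = C * t" using t by (simp add: set_lebesgue_integral_def mult.commute)
  finally have "measure_pmf.expectation (p t x) f \<le> f x + C * t - c * (LINT s:{0..t}|lborel. ?U s)"
    using dynkin[OF fin t, of x] by simp
  moreover have "measure_pmf.expectation (p t x) f = measure_pmf.expectation (p t x) (\<lambda>y. min (V y) K) - K"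
    unfolding f_def using integrable_pmf_bounded[of "\<lambda>y. min (V y) K", OF truncated_bounds(1)[OF K]] by simp
  moreover have "f x \<le> V x - K" by (simp add: f_def)
  ultimately show ?thesis by (simp add: u_def[abs_def])
qed

lemma mean_V_le:
  assumes t: "0 \<le> t"
  shows "mean_le (p t x) V (V x + C * t)"
proof (rule mean_le_truncated)
  fix k :: nat
  have "0 \<le> (LINT s:{0..t}|lborel. measure_pmf.expectation (p s x) (\<lambda>y. V y * indicator {y. V y < real k} y))"
    unfolding set_lebesgue_integral_def using V_nonneg
    by (intro Bochner_Integration.integral_nonneg) (auto intro!: mult_nonneg_nonneg Bochner_Integration.integral_nonneg)
  then have "0 \<le> c * (LINT s:{0..t}|lborel. measure_pmf.expectation (p s x) (\<lambda>y. V y * indicator {y. V y < real k} y))"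
    using c_pos by simp
  then show "measure_pmf.expectation (p t x) (\<lambda>y. min (V y) (real k)) \<le> V x + C * t"
    using expectation_truncated_le[of "real k" t x] t by simp
qed (rule V_nonneg)

lemma integrable_V:
  assumes t: "0 \<le> t"
  shows "integrable (p t x) V" "measure_pmf.expectation (p t x) V \<le> V x + C * t"
  using mean_leD[OF V_nonneg _ mean_V_le[OF t]] t V_nonneg[of x] C_nonneg by auto

text \<open>
  \<open>E V(X\<^sub>T) \<le> E V(X\<^sub>s) + C T\<close> for every \<open>s \<le> T\<close>; averaging over \<open>s\<close> and bounding the occupation
  integral by the drift condition replaces Gronwall's inequality.
\<close>

lemma mean_V_contraction: "mean_le (p (2 / c) x) V (V x / 2 + 3 * C / c)"
proof -
  \<comment> \<open>Averaging over time puts the factor \<open>1 / (c * T)\<close> in front of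
    \<open>V x\<close>; this choice makes it 1/2.\<close>
  define T where "T = 2 / c"
  have T: "0 < T" "c * T = 2" using c_pos by (auto simp: T_def)
  define U where "U s = measure_pmf.expectation (p s x) V" for s
  define u where "u k s = measure_pmf.expectation (p s x) (\<lambda>y. V y * indicator {y. V y < real k} y)" for k :: nat and s
  have lim: "(\<lambda>k. u k s) \<longlonglongrightarrow> U s" if s: "0 \<le> s" for s
    unfolding u_def U_def
  proof (rule integral_dominated_convergence[where w = V])
    show "AE y in p s x. (\<lambda>k. V y * indicator {y. V y < real k} y) \<longlonglongrightarrow> V y"
    proof (rule AE_I2)
      fix y
      obtain m :: nat where m: "V y < real m" using reals_Archimedean2 by blast
      have "\<forall>\<^sub>F k in sequentially. V y * indicator {y. V y < real k} y = V y"
        using eventually_ge_at_top[of m] by eventually_elim (use m in auto)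
      then show "(\<lambda>k. V y * indicator {y. V y < real k} y) \<longlonglongrightarrow> V y" by (rule tendsto_eventually)
    qed
    show "AE y in p s x. norm (V y * indicator {y. V y < real k} y) \<le> V y" for k
      using V_nonneg by (auto simp: indicator_def)
  qed (use integrable_V[OF s] in auto)
  have u0: "0 \<le> u k s" for k s
    unfolding u_def using V_nonneg by (intro Bochner_Integration.integral_nonneg) (auto simp: indicator_def)
  have uU: "u k s \<le> U s" if s: "0 \<le> s" for k s
    unfolding u_def U_def
    by (intro integral_mono integrable_V[OF s] integrable_pmf_bounded[OF truncated_bounds(2)])
       (use V_nonneg in \<open>auto simp: indicator_def\<close>)
  have Ub: "U s \<le> V x + C * T" if s: "0 \<le> s" "s \<le> T" for s
    using integrable_V(2)[OF s(1), of x] mult_left_mono[OF s(2) C_nonneg] by (simp add: U_def)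
  have iu: "set_integrable lborel {0..T} (u k)" for k
    unfolding u_def by (rule set_integrable_expectation[OF truncated_bounds(2)]) simp
  \<comment> \<open>Continuity in time is known for bounded functions only, so \<open>U\<close> is
    measurable as the limit of the \<open>u k\<close>.\<close>
  have mU: "(\<lambda>s. indicator {0..T} s *\<^sub>R U s) \<in> borel_measurable lborel"
  proof (rule borel_measurable_LIMSEQ_metric)
    show "(\<lambda>s. indicator {0..T} s *\<^sub>R u k s) \<in> borel_measurable lborel" for k
      using iu[of k] by (simp add: set_integrable_def borel_measurable_integrable)
    show "(\<lambda>k. indicator {0..T} s *\<^sub>R u k s) \<longlonglongrightarrow> indicator {0..T} s *\<^sub>R U s" for s
      using lim[of s] by (auto simp: indicator_def)
  qed
  have ib: "integrable lborel (\<lambda>s. indicator {0..T} s *\<^sub>R (V x + C * T))"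
    using borel_integrable_atLeastAtMost'[OF continuous_on_const, of 0 T "V x + C * T"] by (simp add: set_integrable_def)
  have bnd: "AE s in lborel. norm (indicator {0..T} s *\<^sub>R u k s) \<le> indicator {0..T} s *\<^sub>R (V x + C * T)" for k
    using u0 order_trans[OF uU Ub] by (auto simp: indicator_def)
  have cv: "AE s in lborel. (\<lambda>k. indicator {0..T} s *\<^sub>R u k s) \<longlonglongrightarrow> indicator {0..T} s *\<^sub>R U s"
    using lim by (auto simp: indicator_def)
  have mu: "(\<lambda>s. indicator {0..T} s *\<^sub>R u k s) \<in> borel_measurable lborel" for k
    using iu[of k] by (simp add: set_integrable_def borel_measurable_integrable)
  have iU: "set_integrable lborel {0..T} U"
    unfolding set_integrable_def by (rule integrable_dominated_convergence[OF mU mu ib cv bnd])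
  have "(\<lambda>k. LINT s:{0..T}|lborel. u k s) \<longlonglongrightarrow> (LINT s:{0..T}|lborel. U s)"
    unfolding set_lebesgue_integral_def by (rule integral_dominated_convergence[OF mU mu ib cv bnd])
  moreover have "(LINT s:{0..T}|lborel. u k s) \<le> (V x + C * T) / c" for k
  proof -
    have "0 \<le> measure_pmf.expectation (p T x) (\<lambda>y. min (V y) (real k))"
      using V_nonneg by (intro Bochner_Integration.integral_nonneg) auto
    then have "c * (LINT s:{0..T}|lborel. u k s) \<le> V x + C * T"
      using expectation_truncated_le[of "real k" T x] T by (simp add: u_def)
    then show ?thesis using c_pos by (simp add: pos_le_divide_eq mult.commute)
  qed
  ultimately have occ: "(LINT s:{0..T}|lborel. U s) \<le> (V x + C * T) / c"
    by (intro LIMSEQ_le_const2) auto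
  have UT: "U T - C * T \<le> U s" if s: "0 \<le> s" "s \<le> T" for s
  proof -
    have U0: "0 \<le> U s" unfolding U_def using V_nonneg by (intro Bochner_Integration.integral_nonneg) auto
    have "mean_le (bind_pmf (p s x) (p (T - s))) V (1 * U s + C * (T - s))"
      using s C_nonneg U0 mean_V_le[of "T - s"] V_nonneg integrable_V(1)[OF s(1)]
      by (intro mean_le_bind[of V]) (auto simp: U_def intro!: mean_leI)
    then have "mean_le (p T x) V (U s + C * (T - s))" using p_add[of s "T - s" x] s by simp
    from mean_leD(2)[OF V_nonneg _ this] have "U T \<le> U s + C * (T - s)" using U0 C_nonneg s by (simp add: U_def)
    moreover have "C * (T - s) \<le> C * T" using C_nonneg s by (intro mult_left_mono) auto
    ultimately show ?thesis by simp
  qed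
  have "(LINT s:{0..T}|lborel. U T - C * T) \<le> (LINT s:{0..T}|lborel. U s)"
    using UT by (intro set_integral_mono iU borel_integrable_atLeastAtMost' continuous_on_const) auto
  then have "T * (U T - C * T) \<le> (V x + C * T) / c"
    using T occ by (simp add: set_lebesgue_integral_def)
  then have "c * T * (U T - C * T) \<le> V x + C * T" using c_pos by (simp add: pos_le_divide_eq mult_ac)
  then have "U T \<le> V x / 2 + 3 / 2 * (C * T)" unfolding T(2) by (simp add: field_simps)
  also have "3 / 2 * (C * T) = 3 * C / c" by (simp add: T_def)
  finally have "U T \<le> V x / 2 + 3 * C / c" .
  then show ?thesis
    using V_nonneg integrable_V(1)[of T x] T by (intro mean_leI) (auto simp: U_def T_def)
qed

lemma p_multiple: "0 \<le> T \<Longrightarrow> p (real n * T) x = kernel_power (p T) n x"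
proof (induction n)
  case 0
  show ?case by (simp add: p_0)
next
  case (Suc n)
  have "p (real n * T + T) x = bind_pmf (p (real n * T) x) (p T)" using Suc.prems by (intro p_add) auto
  then show ?case using Suc by (simp add: algebra_simps)
qed

lemma mean_V_multiple: "mean_le (p (real n * (2 / c)) x) V (V x / 2 ^ n + 6 * C / c)"
proof -
  have "0 \<le> 2 / c" "0 \<le> 3 * C / c" using C_nonneg c_pos by auto
  then show ?thesis
    using mean_le_kernel_power[OF V_nonneg _ mean_V_contraction, of n x] by (subst p_multiple) auto
qed

text \<open>Whole periods of length \<open>2 / c\<close> leave at most
  \<open>V x + 6 * C / c\<close>, and the leftover time adds at most \<open>2 * C / c\<close>.
  Unlike \<open>mean_V_le\<close>, the bound does not grow with \<open>t\<close>.\<close>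

lemma mean_V_bounded:
  assumes t: "0 \<le> t"
  shows "mean_le (p t x) V (V x + 8 * C / c)"
proof -
  define T where "T = 2 / c"
  define n where "n = nat \<lfloor>t / T\<rfloor>"
  have T: "0 < T" using c_pos by (simp add: T_def)
  have n: "real n * T \<le> t" "t - real n * T \<le> T"
  proof -
    have "real n \<le> t / T" "t / T \<le> real n + 1" using t T by (auto simp: n_def)
    then show "real n * T \<le> t" "t - real n * T \<le> T" using T by (simp_all add: field_simps)
  qed
  have Cc: "0 \<le> C / c" using C_nonneg c_pos by simp
  have "V x / 2 ^ n \<le> V x" using V_nonneg[of x] by (simp add: divide_le_eq mult_ge1_I mult_le_cancel_left1 self_le_power)
  then have "mean_le (p (real n * T) x) V (V x + 6 * C / c)"
    unfolding T_def by (intro mean_le_mono[OF mean_V_multiple]) simp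
  then have "mean_le (bind_pmf (p (real n * T) x) (p (t - real n * T))) V (1 * (V x + 6 * C / c) + C * (t - real n * T))"
    using n C_nonneg V_nonneg Cc mean_V_le[of "t - real n * T"] by (intro mean_le_bind[of V]) auto
  then have "mean_le (p t x) V (V x + 6 * C / c + C * (t - real n * T))"
    using p_add[of "real n * T" "t - real n * T" x] n T by simp
  moreover have "C * (t - real n * T) \<le> C * T" using n C_nonneg by (intro mult_left_mono) auto
  moreover have "C * T = 2 * C / c" by (simp add: T_def)
  moreover have "8 * C / c = 6 * C / c + 2 * C / c" by (simp add: add_divide_distrib[symmetric])
  ultimately show ?thesis by (elim mean_le_mono) linarith
qed

text \<open>Integrability of V is the goal, so invariance is applied to \<open>min V N\<close>.
  After \<open>k\<close> periods its mean is at most that of \<open>min N (V / 2 ^ k + D)\<close>,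
  which tends to \<open>min N D\<close> by dominated convergence.\<close>

lemma mean_V_invariant:
  assumes inv: "\<And>t. 0 \<le> t \<Longrightarrow> bind_pmf \<pi> (p t) = \<pi>"
  shows "mean_le \<pi> V (6 * C / c)"
proof (rule mean_le_truncated)
  fix N :: nat
  define D where "D = 6 * C / c"
  have D: "0 \<le> D" using C_nonneg c_pos by (simp add: D_def)
  let ?f = "\<lambda>y. min (V y) (real N)"
  let ?g = "\<lambda>k x. min (real N) (V x / 2 ^ k + D)"
  have fN: "\<bar>?f y\<bar> \<le> real N" for y by (rule truncated_bounds) simp
  have g: "\<bar>?g k x\<bar> \<le> real N" for k x using V_nonneg[of x] D by (auto simp: min_def)
  have "measure_pmf.expectation \<pi> ?f \<le> measure_pmf.expectation \<pi> (?g k)" for k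
  proof -
    have "measure_pmf.expectation (p (real k * (2 / c)) x) ?f \<le> ?g k x" for x
    proof -
      have "0 \<le> V x / 2 ^ k + D" using V_nonneg[of x] D by simp
      note V = mean_leD[OF V_nonneg this mean_V_multiple[of k x, folded D_def]]
      have "measure_pmf.expectation (p (real k * (2 / c)) x) ?f \<le> measure_pmf.expectation (p (real k * (2 / c)) x) V"
        by (intro integral_mono V integrable_pmf_bounded[OF fN]) auto
      then show ?thesis using V(2) expectation_bounded[of ?f, OF fN, of "p (real k * (2 / c)) x"] by auto
    qed
    then have "measure_pmf.expectation \<pi> (\<lambda>x. measure_pmf.expectation (p (real k * (2 / c)) x) ?f) \<le> measure_pmf.expectation \<pi> (?g k)"
      by (intro integral_mono integrable_pmf_bounded[OF g] integrable_pmf_bounded[OF expectation_bounded[OF fN]])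
    moreover have "0 \<le> real k * (2 / c)" using c_pos by simp
    ultimately show ?thesis using expectation_bind_bounded[of ?f, OF fN, of \<pi> "p (real k * (2 / c))"] inv by simp
  qed
  moreover have "(\<lambda>k. measure_pmf.expectation \<pi> (?g k)) \<longlonglongrightarrow> measure_pmf.expectation \<pi> (\<lambda>x. min (real N) (0 + D))"
  proof (rule integral_dominated_convergence[where w = "\<lambda>_. real N"])
    show "AE x in \<pi>. (\<lambda>k. ?g k x) \<longlonglongrightarrow> min (real N) (0 + D)"
    proof (rule AE_I2)
      fix x
      have "(\<lambda>k. V x * (1 / 2) ^ k) \<longlonglongrightarrow> V x * 0" by (intro tendsto_intros LIMSEQ_realpow_zero) auto
      then have "(\<lambda>k. V x / 2 ^ k) \<longlonglongrightarrow> 0" by (simp add: power_divide)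
      then show "(\<lambda>k. ?g k x) \<longlonglongrightarrow> min (real N) (0 + D)" by (intro tendsto_intros)
    qed
  qed (use g in auto)
  ultimately have "measure_pmf.expectation \<pi> ?f \<le> measure_pmf.expectation \<pi> (\<lambda>x. min (real N) (0 + D))"
    by (intro LIMSEQ_le_const) auto
  then show "measure_pmf.expectation \<pi> ?f \<le> 6 * C / c" by (simp add: D_def)
qed (rule V_nonneg)

text \<open>Contraction gives setwise limits \<open>L\<close> of the laws from \<open>o'\<close>. To
  make a measure of them, Fatou bounds the sum of the point limits by 1, tightness supplied by V
  bounds it from below, and \<open>\<pi> \<le> L\<close> on a set and on its complement forces
  equality.\<close>

lemma exponential_ergodicity:
  assumes reach: "\<And>t x. 0 < t \<Longrightarrow> 0 < pmf (p t x) o'"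
  obtains \<pi> \<kappa> where "0 < \<kappa>" "\<And>t. 0 \<le> t \<Longrightarrow> bind_pmf \<pi> (p t) = \<pi>"
    "\<And>x. \<exists>M. \<forall>t\<ge>0. \<forall>B. \<bar>measure (p t x) B - measure \<pi> B\<bar> \<le> M * exp (- \<kappa> * t)"
proof -
  define T where "T = 2 / c"
  define K where "K = 3 * C / c"
  define D where "D = 8 * C / c"
  have T: "0 < T" using c_pos by (simp add: T_def)
  have K: "0 \<le> K" and D: "0 \<le> D" using C_nonneg c_pos by (simp_all add: K_def D_def)
  \<comment> \<open>Inserting \<open>o'\<close> keeps the set nonempty, as \<open>Min\<close>
    requires.\<close>
  let ?S = "insert o' {x. V x \<le> 8 * K + 1}"
  define \<alpha> where "\<alpha> = Min ((\<lambda>x. pmf (p T x) o') ` ?S)"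
  have fin: "finite ?S" using finite_sublevel by simp
  have "0 < \<alpha>" using fin reach[OF T] by (simp add: \<alpha>_def)
  moreover have "\<alpha> \<le> pmf (p T x) o'" if "V x \<le> 8 * K + 1" for x
    unfolding \<alpha>_def using fin that by (intro Min_le) auto
  ultimately obtain \<beta> \<kappa> where \<beta>: "0 < \<beta>" and \<kappa>: "0 < \<kappa>" "\<kappa> < 1"
    and contr: "\<And>n p' q a b B. 0 \<le> a \<Longrightarrow> 0 \<le> b \<Longrightarrow> mean_le p' V a \<Longrightarrow> mean_le q V b \<Longrightarrow>
       \<bar>measure (bind_pmf p' (kernel_power (p T) n)) B - measure (bind_pmf q (kernel_power (p T) n)) B\<bar>
         \<le> \<kappa> ^ n * (2 + \<beta> * a + \<beta> * b)"
    using kernel_power_contraction[of V K "p T" \<alpha> o', OF V_nonneg K mean_V_contraction[folded T_def K_def]]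
    by metis
  define G where "G x = 2 + \<beta> * (V x + D) + \<beta> * (V o' + D)" for x
  have G: "0 \<le> G x" for x using \<beta> V_nonneg D by (simp add: G_def)
  \<comment> \<open>The contraction acts during the last \<open>n * T\<close> units of time. The
    laws before that have V-means bounded uniformly in time, so \<open>t\<close> and
    \<open>s\<close> may be different.\<close>
  have key: "\<bar>measure (p t x) B - measure (p s o') B\<bar> \<le> \<kappa> ^ n * G x"
    if "real n * T \<le> t" "real n * T \<le> s" for n t s x B
  proof -
    have "p (real n * T) = kernel_power (p T) n" using T by (intro ext p_multiple) simp
    then have eq: "p t y = bind_pmf (p (t - real n * T) y) (kernel_power (p T) n)" if "real n * T \<le> t" for t y
      using p_add[of "t - real n * T" "real n * T" y] that T by simp
    show ?thesis
      unfolding eq[OF that(1), of x] eq[OF that(2), of o'] G_def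
      using that V_nonneg D mean_V_bounded[folded D_def] by (intro contr) auto
  qed
  define L where "L B = lim (\<lambda>k. measure (p (real k * T) o') B)" for B
  have zero: "(\<lambda>n. \<kappa> ^ n * M) \<longlonglongrightarrow> 0" for M
    using \<kappa> by (auto intro!: tendsto_mult_left_zero LIMSEQ_realpow_zero)
  have L: "(\<lambda>k. measure (p (real k * T) o') B) \<longlonglongrightarrow> L B" for B
  proof -
    have "Cauchy (\<lambda>k. measure (p (real k * T) o') B)"
    proof (rule metric_CauchyI)
      fix e :: real assume e: "0 < e"
      obtain n where n: "\<kappa> ^ n * G o' < e"
        using order_tendstoD(2)[OF zero e] by (auto simp: eventually_sequentially)
      have "dist (measure (p (real k * T) o') B) (measure (p (real l * T) o') B) < e" if "n \<le> k" "n \<le> l" for k l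
        using key[of n "real k * T" "real l * T" o' B] that T n by (auto simp: dist_real_def mult_right_mono)
      then show "\<exists>M. \<forall>m\<ge>M. \<forall>n\<ge>M. dist (measure (p (real m * T) o') B) (measure (p (real n * T) o') B) < e" by blast
    qed
    then show ?thesis unfolding L_def by (simp add: Cauchy_convergent_iff convergent_LIMSEQ_iff)
  qed
  have L_rate: "\<bar>measure (p t x) B - L B\<bar> \<le> \<kappa> ^ n * G x" if "real n * T \<le> t" for n t x B
  proof (rule LIMSEQ_le_const2)
    show "(\<lambda>k. \<bar>measure (p t x) B - measure (p (real k * T) o') B\<bar>) \<longlonglongrightarrow> \<bar>measure (p t x) B - L B\<bar>"
      by (intro tendsto_intros L)
    show "\<exists>N. \<forall>k\<ge>N. \<bar>measure (p t x) B - measure (p (real k * T) o') B\<bar> \<le> \<kappa> ^ n * G x"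
      using key[OF that] T by (auto intro!: exI[of _ n] mult_right_mono)
  qed
  have L_lim: "(\<lambda>k. measure (p (real k * T + t) o') B) \<longlonglongrightarrow> L B" if t: "0 \<le> t" for t B
  proof (rule LIM_zero_cancel, rule Lim_null_comparison[OF _ zero])
    show "\<forall>\<^sub>F k in sequentially. norm (measure (p (real k * T + t) o') B - L B) \<le> \<kappa> ^ k * G o'"
      using L_rate t by (intro always_eventually) auto
  qed
  have L_single: "(\<lambda>k. pmf (p (real k * T) o') y) \<longlonglongrightarrow> L {y}" for y
    using L[of "{y}"] by (simp add: measure_pmf_single)
  have L_nonneg: "0 \<le> L B" for B by (rule LIMSEQ_le_const[OF L]) auto
  have L_compl: "L B + L (- B) = 1" for B
  proof (rule LIMSEQ_unique)
    show "(\<lambda>k. measure (p (real k * T) o') B + measure (p (real k * T) o') (- B)) \<longlonglongrightarrow> L B + L (- B)"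
      by (intro tendsto_intros L)
    have "measure q B + measure q (- B) = 1" for q :: "'s pmf"
      using measure_pmf.prob_compl[of B q] by (simp add: Compl_eq_Diff_UNIV)
    then show "(\<lambda>k. measure (p (real k * T) o') B + measure (p (real k * T) o') (- B)) \<longlonglongrightarrow> 1" by simp
  qed
  have fatou: "(\<integral>\<^sup>+y. ennreal (L {y}) * ennreal (F y) \<partial>count_space UNIV) \<le> ennreal l"
    if "(\<lambda>k. \<integral>\<^sup>+y. ennreal (F y) \<partial>measure_pmf (p (real k * T) o')) \<longlonglongrightarrow> ennreal l" for F l
    using nn_integral_pmf_Fatou[OF L_single, of F] lim_imp_Liminf[OF _ that] by simp
  have total: "(\<integral>\<^sup>+y. ennreal (L {y}) \<partial>count_space UNIV) = 1"
  proof (rule antisym)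
    show "(\<integral>\<^sup>+y. ennreal (L {y}) \<partial>count_space UNIV) \<le> 1"
      using fatou[of "\<lambda>_. 1" 1] by simp
    \<comment> \<open>By Markov's inequality, mass at least \<open>1 - (V o' + D) / N\<close> stays
      in the finite set \<open>F\<close> at all times; on a finite set the limit is the sum of the
      point limits.\<close>
    have "ennreal (1 - (V o' + D) / N) \<le> (\<integral>\<^sup>+y. ennreal (L {y}) \<partial>count_space UNIV)" if N: "0 < N" for N
    proof -
      define F where "F = {x. V x \<le> N}"
      have F: "finite F" using finite_sublevel by (simp add: F_def)
      have "1 - (V o' + D) / N \<le> L F"
      proof (rule LIMSEQ_le_const[OF L], intro exI allI impI)
        fix k :: nat
        have "0 \<le> real k * T" using T by simp
        then have "mean_le (p (real k * T) o') V (V o' + D)" unfolding D_def by (rule mean_V_bounded)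
        note V = mean_leD[OF V_nonneg _ this]
        have "measure (p (real k * T) o') {x\<in>space (p (real k * T) o'). N \<le> V x} \<le> measure_pmf.expectation (p (real k * T) o') V / N"
          using N V_nonneg V D by (intro integral_Markov_inequality_measure[where A = "{}"]) auto
        also have "\<dots> \<le> (V o' + D) / N" using V D V_nonneg N by (intro divide_right_mono) auto
        finally have "measure (p (real k * T) o') {x. N \<le> V x} \<le> (V o' + D) / N" by simp
        moreover have "measure (p (real k * T) o') (- F) \<le> measure (p (real k * T) o') {x. N \<le> V x}"
          by (intro measure_pmf.finite_measure_mono) (auto simp: F_def)
        moreover have "measure (p (real k * T) o') (- F) = 1 - measure (p (real k * T) o') F"
          using measure_pmf.prob_compl[of F] by (simp add: Compl_eq_Diff_UNIV)
        ultimately show "1 - (V o' + D) / N \<le> measure (p (real k * T) o') F" by linarith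
      qed
      also have "L F = (\<Sum>y\<in>F. L {y})"
      proof (rule LIMSEQ_unique[OF L])
        show "(\<lambda>k. measure (p (real k * T) o') F) \<longlonglongrightarrow> (\<Sum>y\<in>F. L {y})"
          using F by (simp add: measure_measure_pmf_finite) (intro tendsto_sum L_single)
      qed
      finally have "ennreal (1 - (V o' + D) / N) \<le> (\<Sum>y\<in>F. ennreal (L {y}))"
        using L_nonneg by (simp add: ennreal_leI)
      also have "\<dots> = (\<integral>\<^sup>+y. ennreal (L {y}) * indicator F y \<partial>count_space UNIV)"
        using F by (simp add: nn_integral_count_space_indicator[symmetric] nn_integral_count_space_finite)
      also have "\<dots> \<le> (\<integral>\<^sup>+y. ennreal (L {y}) \<partial>count_space UNIV)"
        by (intro nn_integral_mono) (auto simp: indicator_def)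
      finally show ?thesis .
    qed
    then have ev: "\<forall>\<^sub>F N in at_top. ennreal (1 - (V o' + D) / N) \<le> (\<integral>\<^sup>+y. ennreal (L {y}) \<partial>count_space UNIV)"
      using eventually_gt_at_top[of 0] by (rule eventually_mono[rotated])
    have lim: "((\<lambda>N. ennreal (1 - (V o' + D) / N)) \<longlongrightarrow> ennreal (1 - 0)) at_top"
      by (intro tendsto_intros tendsto_divide_0[OF tendsto_const] filterlim_at_top_imp_at_infinity filterlim_ident)
    show "1 \<le> (\<integral>\<^sup>+y. ennreal (L {y}) \<partial>count_space UNIV)"
      using tendsto_upperbound[OF lim ev] by simp
  qed
  define \<pi> where "\<pi> = embed_pmf (\<lambda>y. L {y})"
  have \<pi>_pmf: "pmf \<pi> y = L {y}" for y
    unfolding \<pi>_def using L_nonneg total by (intro pmf_embed_pmf) auto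
  have \<pi>_fatou: "(\<integral>\<^sup>+y. ennreal (F y) \<partial>measure_pmf \<pi>) \<le> ennreal l"
    if "(\<lambda>k. \<integral>\<^sup>+y. ennreal (F y) \<partial>measure_pmf (p (real k * T) o')) \<longlonglongrightarrow> ennreal l" for F l
    using fatou[OF that] by (simp add: nn_integral_measure_pmf \<pi>_pmf)
  have \<pi>_le: "measure \<pi> B \<le> L B" for B
  proof -
    have "(\<lambda>k. \<integral>\<^sup>+y. ennreal (indicator B y) \<partial>measure_pmf (p (real k * T) o')) \<longlonglongrightarrow> ennreal (L B)"
      using L[of B] by (simp add: ennreal_indicator measure_pmf.emeasure_eq_measure)
    from \<pi>_fatou[OF this] show ?thesis
      using L_nonneg by (simp add: ennreal_indicator measure_pmf.emeasure_eq_measure)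
  qed
  have \<pi>_L: "measure \<pi> B = L B" for B
    using \<pi>_le[of B] \<pi>_le[of "- B"] L_compl[of B] measure_pmf.prob_compl[of B \<pi>]
    by (simp add: Compl_eq_Diff_UNIV)
  \<comment> \<open>Fatou gives one inequality between the mass functions at every point; as both
    have total mass 1, they coincide.\<close>
  have inv: "bind_pmf \<pi> (p t) = \<pi>" if t: "0 \<le> t" for t
  proof (rule ccontr)
    assume "bind_pmf \<pi> (p t) \<noteq> \<pi>"
    then obtain z where z: "pmf \<pi> z < pmf (bind_pmf \<pi> (p t)) z" using pmf_neq_exists_less by metis
    have eq: "(\<integral>\<^sup>+y. ennreal (pmf (p t y) z) \<partial>measure_pmf q) = ennreal (pmf (bind_pmf q (p t)) z)" for q
      by (simp add: pmf_bind pmf_le_1 nn_integral_eq_integral integrable_pmf_bounded[of _ 1])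
    have "(\<lambda>k. \<integral>\<^sup>+y. ennreal (pmf (p t y) z) \<partial>measure_pmf (p (real k * T) o')) \<longlonglongrightarrow> ennreal (L {z})"
      unfolding eq using L_lim[OF t, of "{z}"] t T by (simp add: p_add measure_pmf_single)
    from \<pi>_fatou[OF this] show False using z L_nonneg unfolding eq by (simp add: \<pi>_pmf)
  qed
  define \<eta> where "\<eta> = - ln \<kappa> / T"
  have \<eta>: "0 < \<eta>" using \<kappa> T by (simp add: \<eta>_def divide_neg_pos)
  have "\<bar>measure (p t x) B - measure \<pi> B\<bar> \<le> G x / \<kappa> * exp (- \<eta> * t)" if t: "0 \<le> t" for t x B
  proof -
    define n where "n = nat \<lfloor>t / T\<rfloor>"
    have n: "real n \<le> t / T" "t / T \<le> real n + 1" using t T by (auto simp: n_def)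
    have "\<bar>measure (p t x) B - measure \<pi> B\<bar> \<le> \<kappa> ^ n * G x"
      unfolding \<pi>_L using n T by (intro L_rate) (simp add: field_simps)
    also have "\<kappa> ^ n = exp (real n * ln \<kappa>)" using \<kappa> by (simp add: exp_of_nat_mult)
    \<comment> \<open>The incomplete last period is what costs the factor
      \<open>1 / \<kappa>\<close>.\<close>
    also have "\<dots> \<le> exp ((t / T - 1) * ln \<kappa>)" using n \<kappa> by (simp add: mult_right_mono_neg)
    also have "(t / T - 1) * ln \<kappa> = - \<eta> * t - ln \<kappa>" by (simp add: \<eta>_def left_diff_distrib)
    also have "exp \<dots> = exp (- \<eta> * t) / \<kappa>" using \<kappa> by (simp add: exp_diff)
    finally show ?thesis using G[of x] by (simp add: mult_right_mono mult.commute)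
  qed
  with \<eta> inv show ?thesis by (intro that[of \<eta> \<pi>]) blast+
qed

end

section \<open>The queue as a jump semigroup\<close>

definition transition :: "('s \<Rightarrow> 'w measure) \<Rightarrow> (real \<Rightarrow> 'w \<Rightarrow> 's) \<Rightarrow> real \<Rightarrow> 's \<Rightarrow> 's pmf" where
  "transition P X t x = Abs_pmf (distr (P x) (count_space UNIV) (X t))"

text \<open>A law on a countable space is carried by its atoms, which is what \<open>Abs_pmf\<close>
  asks for.\<close>

lemma measure_pmf_Abs_countable:
  fixes M :: "'s measure"
  assumes "countable (UNIV :: 's set)" "prob_space M" "sets M = UNIV"
  shows "measure_pmf (Abs_pmf M) = M"
proof -
  interpret prob_space M by fact
  have "AE x in M. measure M {x} \<noteq> 0"
    using AE_support_countable[OF assms(3)] assms(1) by auto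
  then show ?thesis using assms by (intro Abs_pmf_inverse) auto
qed

lemma measure_pmf_transition:
  assumes "markov_process UNIV P X" "0 \<le> t"
  shows "measure_pmf (transition P X t x) = distr (P x) (count_space UNIV) (X t)"
proof -
  have X: "X t \<in> measurable (P x) (count_space UNIV)" "prob_space (P x)" "countable (UNIV :: 'a set)"
    using assms unfolding markov_process_def by auto
  then show ?thesis
    unfolding transition_def by (intro measure_pmf_Abs_countable prob_space.prob_space_distr) auto
qed

lemma measure_transition:
  assumes "markov_process UNIV P X" "0 \<le> t"
  shows "measure (transition P X t x) B = measure (P x) (X t -` B \<inter> space (P x))"
  using assms by (simp add: measure_pmf_transition) (simp add: measure_distr markov_process_def)

lemma expectation_transition:
  fixes f :: "'s \<Rightarrow> real"
  assumes "markov_process UNIV P X" "0 \<le> t"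
  shows "measure_pmf.expectation (transition P X t x) f = (LINT \<omega>|P x. f (X t \<omega>))"
  using assms by (simp add: measure_pmf_transition) (simp add: integral_distr markov_process_def)

lemma transition_0:
  assumes mp: "markov_process UNIV P X"
  shows "transition P X 0 x = return_pmf x"
proof (rule ccontr)
  assume "transition P X 0 x \<noteq> return_pmf x"
  then obtain y where y: "pmf (transition P X 0 x) y < pmf (return_pmf x) y" using pmf_neq_exists_less by blast
  then have "y = x" by (cases "x = y") (auto simp: not_less[symmetric])
  interpret prob_space "P x" using mp by (simp add: markov_process_def)
  have [measurable]: "X 0 \<in> measurable (P x) (count_space UNIV)" and ae: "AE \<omega> in P x. X 0 \<omega> = x"
    using mp by (auto simp: markov_process_def)
  have "pmf (transition P X 0 x) x = prob (X 0 -` {x} \<inter> space (P x))"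
    by (simp add: measure_transition[OF mp] measure_pmf_single[symmetric])
  also have "\<dots> = 1"
    by (subst prob_eq_1) (use ae in \<open>auto intro!: measurable_sets[of "X 0" _ "count_space UNIV"]\<close>)
  finally show False using y \<open>y = x\<close> by simp
qed

text \<open>The Markov property, used with the whole space as the past event.\<close>

lemma transition_add:
  assumes mp: "markov_process UNIV P X" and st: "0 \<le> s" "0 \<le> t"
  shows "transition P X (s + t) x = bind_pmf (transition P X s x) (transition P X t)"
proof (rule pmf_eqI)
  fix y
  have "space (P x) \<in> past_events UNIV (P x) X s" unfolding past_events_def by (rule sigma_sets_top)
  then have "measure (P x) (space (P x) \<inter> (X (s + t) -` {y} \<inter> space (P x))) =
       (LINT \<omega>:space (P x)|P x. measure (P (X s \<omega>)) (X t -` {y} \<inter> space (P (X s \<omega>))))"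
    using mp st unfolding markov_process_def by blast
  moreover have "space (P x) \<inter> (X (s + t) -` {y} \<inter> space (P x)) = X (s + t) -` {y} \<inter> space (P x)" by auto
  moreover have "(LINT \<omega>:space (P x)|P x. g \<omega>) = (LINT \<omega>|P x. g \<omega>)" for g :: "'b \<Rightarrow> real"
    unfolding set_lebesgue_integral_def by (rule Bochner_Integration.integral_cong) auto
  ultimately have "measure (transition P X (s + t) x) {y} = (LINT \<omega>|P x. measure (transition P X t (X s \<omega>)) {y})"
    using st by (simp add: measure_transition[OF mp])
  also have "\<dots> = measure_pmf.expectation (transition P X s x) (\<lambda>z. measure (transition P X t z) {y})"
    by (simp add: expectation_transition[OF mp st(1)])
  finally show "pmf (transition P X (s + t) x) y = pmf (bind_pmf (transition P X s x) (transition P X t)) y"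
    by (simp add: pmf_bind measure_pmf_single)
qed

section \<open>Arrivals and departures as jumps of a semigroup\<close>

context
  fixes lam mu gam :: "nat \<Rightarrow> 'm::finite \<Rightarrow> real" and n :: nat and \<zeta> :: "nat ^ 'm \<Rightarrow> nat ^ 'm"
begin

definition queue_rate :: "'m + 'm \<Rightarrow> nat ^ 'm \<Rightarrow> real" where
  "queue_rate j x = (case j of Inl i \<Rightarrow> lam n i
     | Inr i \<Rightarrow> mu n i * real (\<zeta> x $ i) + gam n i * (real (x $ i) - real (\<zeta> x $ i)))"

definition queue_jump :: "'m + 'm \<Rightarrow> nat ^ 'm \<Rightarrow> nat ^ 'm" where
  "queue_jump j x = (case j of Inl i \<Rightarrow> x + axis i 1 | Inr i \<Rightarrow> x - axis i 1)"

lemma jump_generator_queue: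
  "jump_generator UNIV queue_rate queue_jump f x = queue_generator lam mu gam n (\<zeta> x) f x"
  by (simp add: jump_generator_def queue_generator_def queue_rate_def queue_jump_def
      UNIV_Plus_UNIV[symmetric] sum.Plus del: UNIV_Plus_UNIV One_nat_def)

text \<open>Even with truncated subtraction a jump lowers a coordinate by at most 1, so the
  preimages lie in a box.\<close>

lemma finite_vimage_queue_jump: "finite (queue_jump j -` {y})"
proof (rule finite_subset[OF _ finite_vec_bounded[of "\<lambda>i. y $ i + 1"]])
  show "queue_jump j -` {y} \<subseteq> {x. \<forall>i. x $ i \<le> y $ i + 1}"
    by (auto simp: queue_jump_def axis_def split: sum.splits)
qed

lemma jump_semigroup_queue:
  assumes lam: "\<And>i. 0 \<le> lam n i" and mu: "\<And>i. 0 < mu n i" and gam: "\<And>i. 0 \<le> gam n i"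
    and policy: "stationary_policy n \<zeta>" and process: "queue_process lam mu gam n \<zeta> P X"
  shows "jump_semigroup (transition P X) UNIV queue_rate queue_jump"
proof
  have mp: "markov_process UNIV P X" using process by (simp add: queue_process_def)
  show "finite (UNIV :: ('m + 'm) set)" by simp
  have "\<zeta> x $ i \<le> x $ i" for x i using policy by (simp add: stationary_policy_def work_conserving_def)
  then show "0 \<le> queue_rate j x" for j x
    using lam mu gam by (auto simp: queue_rate_def less_imp_le split: sum.splits)
  show "finite (queue_jump j -` {y})" for j y by (rule finite_vimage_queue_jump)
  show "transition P X 0 x = return_pmf x" for x by (rule transition_0[OF mp])
  show "transition P X (s + t) x = bind_pmf (transition P X s x) (transition P X t)" if "0 \<le> s" "0 \<le> t" for s t x
    by (rule transition_add[OF mp that])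
  show "measure_pmf.expectation (transition P X t x) f = f x + (LINT s:{0..t}|lborel.
      measure_pmf.expectation (transition P X s x) (jump_generator UNIV queue_rate queue_jump f))"
    if f: "finite {y. f y \<noteq> 0}" and t: "0 \<le> t" for f t x
  proof -
    have eq: "jump_generator UNIV queue_rate queue_jump f = (\<lambda>x. queue_generator lam mu gam n (\<zeta> x) f x)"
      by (rule ext) (rule jump_generator_queue)
    have "in_extended_generator UNIV P X f (\<lambda>x. queue_generator lam mu gam n (\<zeta> x) f x)"
      using process f by (simp add: queue_process_def has_generator_def)
    then have "(LINT \<omega>|P x. f (X t \<omega>)) = f x
        + (LINT s:{0..t}|lborel. (LINT \<omega>|P x. queue_generator lam mu gam n (\<zeta> (X s \<omega>)) f (X s \<omega>)))"
      using t by (simp add: in_extended_generator_def)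
    moreover have "(LINT s:{0..t}|lborel. (LINT \<omega>|P x. queue_generator lam mu gam n (\<zeta> (X s \<omega>)) f (X s \<omega>)))
       = (LINT s:{0..t}|lborel. measure_pmf.expectation (transition P X s x) (\<lambda>x. queue_generator lam mu gam n (\<zeta> x) f x))"
      by (rule set_lebesgue_integral_cong) (auto simp: expectation_transition[OF mp])
    ultimately show ?thesis by (simp add: eq expectation_transition[OF mp t])
  qed
qed

text \<open>Work conservation with \<open>n > 0\<close> serves someone in a nonempty system, and a
  departure from that class lowers the head count. The head count is thus the descending measure by
  which the empty state is reached.\<close>

lemma queue_descends:
  assumes n: "0 < n" and mu: "\<And>i. 0 < mu n i" and gam: "\<And>i. 0 \<le> gam n i"
    and policy: "stationary_policy n \<zeta>" and x: "x \<noteq> 0"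
  shows "\<exists>j\<in>UNIV. 0 < queue_rate j x \<and> (\<Sum>i\<in>UNIV. queue_jump j x $ i) < (\<Sum>i\<in>UNIV. x $ i)"
proof -
  have z: "\<zeta> x $ i \<le> x $ i" "(\<Sum>i\<in>UNIV. \<zeta> x $ i) = min n (\<Sum>i\<in>UNIV. x $ i)" for i
    using policy by (auto simp: stationary_policy_def work_conserving_def)
  have "0 < (\<Sum>i\<in>UNIV. x $ i)" using x by (auto simp: vec_eq_iff intro: ccontr)
  then have "(\<Sum>i\<in>UNIV. \<zeta> x $ i) \<noteq> 0" using z n by simp
  then obtain i where i: "0 < \<zeta> x $ i" by auto
  have "0 < queue_rate (Inr i) x"
    using i mu[of i] gam[of i] z(1)[of i] by (auto simp: queue_rate_def intro!: add_pos_nonneg)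
  moreover have "(\<Sum>k\<in>UNIV. queue_jump (Inr i) x $ k) < (\<Sum>k\<in>UNIV. x $ k)"
    using i z(1)[of i] by (intro sum_strict_mono_ex1) (auto simp: queue_jump_def axis_def intro!: exI[of _ i])
  ultimately show ?thesis by blast
qed

end

text \<open>Everything is transported along the bijection \<open>scaled\<close> onto its range: sets
  of scaled states correspond to their preimages.\<close>

lemma exponentially_ergodic_scaled:
  fixes lam mu :: "nat \<Rightarrow> 'm::finite \<Rightarrow> real"
  assumes n: "0 < n" and mp: "markov_process UNIV P X" and \<kappa>: "0 < \<kappa>"
    and inv: "\<And>t. 0 \<le> t \<Longrightarrow> bind_pmf \<pi> (transition P X t) = \<pi>"
    and conv: "\<And>x. \<exists>M. \<forall>t\<ge>0. \<forall>B. \<bar>measure (transition P X t x) B - measure \<pi> B\<bar> \<le> M * exp (- \<kappa> * t)"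
  shows "exponentially_ergodic (scaled_space lam mu n)
           (\<lambda>y. P (unscaled lam mu n y)) (\<lambda>t \<omega>. scaled lam mu n (X t \<omega>))"
proof -
  let ?S = "scaled_space lam mu n" and ?sc = "scaled lam mu n" and ?us = "unscaled lam mu n"
  define \<pi>' where "\<pi>' = distr (measure_pmf \<pi>) (count_space ?S) ?sc"
  have sc: "?sc \<in> measurable (measure_pmf \<pi>) (count_space ?S)" by (auto simp: scaled_space_def)
  have law: "measure (P x) ((\<lambda>\<omega>. ?sc (X t \<omega>)) -` B \<inter> space (P x)) = measure (transition P X t x) (?sc -` B)"
    if "0 \<le> t" for t x B
    using that by (simp add: measure_transition[OF mp] vimage_def)
  have \<pi>': "measure \<pi>' B = measure \<pi> (?sc -` B)" if "B \<subseteq> ?S" for B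
    unfolding \<pi>'_def using that sc by (subst measure_distr) auto
  have "invariant_probability ?S (\<lambda>y. P (?us y)) (\<lambda>t \<omega>. ?sc (X t \<omega>)) \<pi>'"
    unfolding invariant_probability_def
  proof (intro conjI allI impI)
    show "prob_space \<pi>'" unfolding \<pi>'_def by (rule measure_pmf.prob_space_distr[OF sc])
    show "sets \<pi>' = sets (count_space ?S)" by (simp add: \<pi>'_def)
    fix t :: real and B assume t: "0 \<le> t" and B: "B \<subseteq> ?S"
    have "(LINT y|\<pi>'. measure (P (?us y)) ((\<lambda>\<omega>. ?sc (X t \<omega>)) -` B \<inter> space (P (?us y))))
        = (LINT y|\<pi>'. measure (transition P X t (?us y)) (?sc -` B))"
      by (simp add: law[OF t])
    also have "\<dots> = measure_pmf.expectation \<pi> (\<lambda>x. measure (transition P X t x) (?sc -` B))"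
      unfolding \<pi>'_def using sc by (subst integral_distr) (auto simp: unscaled_scaled[OF n])
    also have "\<dots> = measure (bind_pmf \<pi> (transition P X t)) (?sc -` B)"
      using expectation_bind_bounded[of "indicat_real (?sc -` B)" 1 \<pi> "transition P X t"] by (simp add: indicator_def)
    finally show "measure \<pi>' B = (LINT y|\<pi>'. measure (P (?us y)) ((\<lambda>\<omega>. ?sc (X t \<omega>)) -` B \<inter> space (P (?us y))))"
      by (simp add: inv[OF t] \<pi>'[OF B])
  qed
  moreover have "\<exists>M. \<forall>t\<ge>0. tv_dist (distr (P (?us y)) (count_space ?S) (\<lambda>\<omega>. ?sc (X t \<omega>))) \<pi>' \<le> M * exp (- \<kappa> * t)" for y
  proof -
    obtain M where M: "\<And>t B. 0 \<le> t \<Longrightarrow> \<bar>measure (transition P X t (?us y)) B - measure \<pi> B\<bar> \<le> M * exp (- \<kappa> * t)"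
      using conv by blast
    have "tv_dist (distr (P (?us y)) (count_space ?S) (\<lambda>\<omega>. ?sc (X t \<omega>))) \<pi>' \<le> M * exp (- \<kappa> * t)" if t: "0 \<le> t" for t
      unfolding tv_dist_def
    proof (rule cSUP_least)
      fix B assume "B \<in> sets (distr (P (?us y)) (count_space ?S) (\<lambda>\<omega>. ?sc (X t \<omega>)))"
      then have B: "B \<subseteq> ?S" by simp
      have "X t \<in> measurable (P (?us y)) (count_space UNIV)" using mp t by (simp add: markov_process_def)
      then have "(\<lambda>\<omega>. ?sc (X t \<omega>)) \<in> measurable (P (?us y)) (count_space ?S)"
        by (rule measurable_compose) (auto simp: scaled_space_def)
      then show "\<bar>measure (distr (P (?us y)) (count_space ?S) (\<lambda>\<omega>. ?sc (X t \<omega>))) B - measure \<pi>' B\<bar> \<le> M * exp (- \<kappa> * t)"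
        using M[OF t, of "?sc -` B"] B by (subst measure_distr) (auto simp: \<pi>' law[OF t])
    qed auto
    then show ?thesis by blast
  qed
  ultimately show ?thesis unfolding exponentially_ergodic_def using \<kappa> by blast
qed

text \<open>The reverse transport: integrability of V concerns an arbitrary invariant probability,
  not just the one constructed for ergodicity.\<close>

lemma unscaled_invariant_pmf:
  fixes lam mu :: "nat \<Rightarrow> 'm::finite \<Rightarrow> real"
  assumes n: "0 < n" and mp: "markov_process UNIV P X"
    and inv: "invariant_probability (scaled_space lam mu n)
                (\<lambda>y. P (unscaled lam mu n y)) (\<lambda>t \<omega>. scaled lam mu n (X t \<omega>)) \<pi>"
  obtains \<rho> where "\<And>t. 0 \<le> t \<Longrightarrow> bind_pmf \<rho> (transition P X t) = \<rho>"
    "\<And>f :: real ^ 'm \<Rightarrow> real. integrable (measure_pmf \<rho>) (\<lambda>x. f (scaled lam mu n x)) \<Longrightarrow> integrable \<pi> f"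
proof -
  let ?S = "scaled_space lam mu n" and ?sc = "scaled lam mu n" and ?us = "unscaled lam mu n"
  have \<pi>: "prob_space \<pi>" "sets \<pi> = sets (count_space ?S)" using inv by (auto simp: invariant_probability_def)
  have sp: "space \<pi> = ?S" using sets_eq_imp_space_eq[OF \<pi>(2)] by simp
  have us: "?us \<in> measurable \<pi> (count_space UNIV)" unfolding measurable_cong_sets[OF \<pi>(2) refl] by simp
  define \<rho> where "\<rho> = Abs_pmf (distr \<pi> (count_space UNIV) ?us)"
  have "countable (UNIV :: (nat ^ 'm) set)" using mp by (simp add: markov_process_def)
  then have \<rho>: "measure_pmf \<rho> = distr \<pi> (count_space UNIV) ?us"
    unfolding \<rho>_def by (intro measure_pmf_Abs_countable prob_space.prob_space_distr[OF \<pi>(1) us]) auto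
  have scus: "?sc (?us y) = y" if "y \<in> ?S" for y using that by (auto simp: scaled_space_def unscaled_scaled[OF n])
  show ?thesis
  proof (rule that[of \<rho>])
    fix t :: real assume t: "0 \<le> t"
    show "bind_pmf \<rho> (transition P X t) = \<rho>"
    proof (rule pmf_eqI)
      fix z
      have vim: "(\<lambda>\<omega>. ?sc (X t \<omega>)) -` {?sc z} = X t -` {z}" using inj_scaled[OF n, of lam mu] by (auto dest: injD)
      have "measure \<pi> {?sc z} = (LINT y|\<pi>. measure (P (?us y)) ((\<lambda>\<omega>. ?sc (X t \<omega>)) -` {?sc z} \<inter> space (P (?us y))))"
        using inv t by (simp add: invariant_probability_def scaled_space_def)
      also have "\<dots> = (LINT y|\<pi>. pmf (transition P X t (?us y)) z)"
        unfolding vim by (simp add: measure_transition[OF mp t] measure_pmf_single[symmetric])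
      also have "\<dots> = measure_pmf.expectation \<rho> (\<lambda>x. pmf (transition P X t x) z)"
        unfolding \<rho> using us by (subst integral_distr) auto
      also have "measure \<pi> {?sc z} = pmf \<rho> z"
      proof -
        have "?us -` {z} \<inter> space \<pi> = {?sc z}" using scus by (auto simp: sp scaled_space_def unscaled_scaled[OF n])
        then show ?thesis using us by (simp add: measure_pmf_single[symmetric] \<rho> measure_distr)
      qed
      finally show "pmf (bind_pmf \<rho> (transition P X t)) z = pmf \<rho> z" by (simp add: pmf_bind)
    qed
  next
    fix f :: "real ^ 'm \<Rightarrow> real" assume "integrable (measure_pmf \<rho>) (\<lambda>x. f (?sc x))"
    then have "integrable \<pi> (\<lambda>y. f (?sc (?us y)))" unfolding \<rho> using us by (subst (asm) integrable_distr_eq) auto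
    then show "integrable \<pi> f" using scus by (subst (asm) Bochner_Integration.integrable_cong[OF refl, of _ _ f]) (auto simp: sp)
  qed
qed

theorem corollary3p1:
  fixes lam mu gam :: "nat \<Rightarrow> 'm::finite \<Rightarrow> real"
    and lam_lim mu_lim gam_lim rho :: "'m \<Rightarrow> real"
    and n :: nat
  assumes lam_nonneg: "\<And>k i. 0 < k \<Longrightarrow> 0 \<le> lam k i"
    and mu_pos: "\<And>k i. 0 < k \<Longrightarrow> 0 < mu k i"
    and gam_nonneg: "\<And>k i. 0 < k \<Longrightarrow> 0 \<le> gam k i"
    and limits_pos: "\<And>i. 0 < lam_lim i" "\<And>i. 0 < mu_lim i" "\<And>i. 0 \<le> gam_lim i"
    and lam_lim: "\<And>i. (\<lambda>k. lam k i / real k) \<longlonglongrightarrow> lam_lim i"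
    and mu_lim: "\<And>i. (\<lambda>k. mu k i) \<longlonglongrightarrow> mu_lim i"
    and gam_lim: "\<And>i. (\<lambda>k. gam k i) \<longlonglongrightarrow> gam_lim i"
    and lam_second_order: "\<And>i. convergent (\<lambda>k. (lam k i - real k * lam_lim i) / sqrt (real k))"
    and mu_second_order: "\<And>i. convergent (\<lambda>k. sqrt (real k) * (mu k i - mu_lim i))"
    and rho_def: "\<And>i. rho i = lam_lim i / mu_lim i"
    and rho_lim: "\<And>i. (\<lambda>k. lam k i / (real k * mu k i)) \<longlonglongrightarrow> rho i"
    and rho_less: "\<And>i. rho i < 1"
    and rho_sum: "(\<Sum>i\<in>UNIV. rho i) = 1"
    and spare: "0 < spare_capacity lam mu n"
  shows "\<exists>\<theta>>0. \<exists>\<epsilon>\<^sub>0>0. \<exists>C :: real \<Rightarrow> real.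
    (\<forall>\<epsilon>. 0 < \<epsilon> \<and> \<epsilon> < \<epsilon>\<^sub>0 \<longrightarrow>
       0 < C \<epsilon> \<and>
       (\<forall>y \<in> scaled_space lam mu n. \<forall>z \<in> work_conserving n (unscaled lam mu n y).
          scaled_generator lam mu gam n z (lyapunov mu n \<theta> \<epsilon>) y
            \<le> C \<epsilon> - \<epsilon> * (spare_capacity lam mu n / (2 * real CARD('m))) * lyapunov mu n \<theta> \<epsilon> y))
    \<and>
    (\<forall>(\<zeta> :: nat ^ 'm \<Rightarrow> nat ^ 'm) (P :: nat ^ 'm \<Rightarrow> 'w measure) (X :: real \<Rightarrow> 'w \<Rightarrow> nat ^ 'm).
       stationary_policy n \<zeta> \<and> queue_process lam mu gam n \<zeta> P X \<longrightarrow>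
       exponentially_ergodic (scaled_space lam mu n)
         (\<lambda>y. P (unscaled lam mu n y)) (\<lambda>t \<omega>. scaled lam mu n (X t \<omega>))
       \<and> (\<forall>\<epsilon> \<pi>. 0 < \<epsilon> \<and> \<epsilon> < \<epsilon>\<^sub>0 \<and>
            invariant_probability (scaled_space lam mu n)
              (\<lambda>y. P (unscaled lam mu n y)) (\<lambda>t \<omega>. scaled lam mu n (X t \<omega>)) \<pi> \<longrightarrow>
            integrable \<pi> (lyapunov mu n \<theta> \<epsilon>)))"
proof -
  have n: "0 < n" using spare by (cases "n = 0") (auto simp: spare_capacity_def)
  note rates = lam_nonneg[OF n] mu_pos[OF n] gam_nonneg[OF n]
  obtain \<theta> \<epsilon>\<^sub>0 and C :: "real \<Rightarrow> real" where \<theta>: "0 < \<theta>" and \<epsilon>\<^sub>0: "0 < \<epsilon>\<^sub>0"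
    and C: "\<And>\<epsilon>. 0 < \<epsilon> \<Longrightarrow> \<epsilon> < \<epsilon>\<^sub>0 \<Longrightarrow> 0 < C \<epsilon>"
    and drift: "\<And>\<epsilon> x z. 0 < \<epsilon> \<Longrightarrow> \<epsilon> < \<epsilon>\<^sub>0 \<Longrightarrow> z \<in> work_conserving n x \<Longrightarrow>
       queue_generator lam mu gam n z (lyapunov mu n \<theta> \<epsilon> \<circ> scaled lam mu n) x
         \<le> C \<epsilon> - \<epsilon> * (spare_capacity lam mu n / (2 * real CARD('m))) * lyapunov mu n \<theta> \<epsilon> (scaled lam mu n x)"
    using queue_drift[of lam n mu gam, OF rates spare] by metis
  have ergodic: "exponentially_ergodic (scaled_space lam mu n)
         (\<lambda>y. P (unscaled lam mu n y)) (\<lambda>t \<omega>. scaled lam mu n (X t \<omega>))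
       \<and> (\<forall>\<epsilon> \<pi>. 0 < \<epsilon> \<and> \<epsilon> < \<epsilon>\<^sub>0 \<and>
            invariant_probability (scaled_space lam mu n)
              (\<lambda>y. P (unscaled lam mu n y)) (\<lambda>t \<omega>. scaled lam mu n (X t \<omega>)) \<pi> \<longrightarrow>
            integrable \<pi> (lyapunov mu n \<theta> \<epsilon>))"
    if policy: "stationary_policy n \<zeta>" and process: "queue_process lam mu gam n \<zeta> P X"
    for \<zeta> and P :: "nat ^ 'm \<Rightarrow> 'w measure" and X
  proof -
    have mp: "markov_process UNIV P X" using process by (simp add: queue_process_def)
    let ?r = "queue_rate lam mu gam n \<zeta>"
    let ?V = "\<lambda>\<epsilon> x. lyapunov mu n \<theta> \<epsilon> (scaled lam mu n x)"
    interpret jump_semigroup "transition P X" UNIV ?r queue_jump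
      by (rule jump_semigroup_queue[OF rates policy process])
    have sg: "jump_semigroup_drift (transition P X) UNIV ?r queue_jump (?V \<epsilon>) (C \<epsilon>) (\<epsilon> * (spare_capacity lam mu n / (2 * real CARD('m))))"
      if \<epsilon>: "0 < \<epsilon>" "\<epsilon> < \<epsilon>\<^sub>0" for \<epsilon>
    proof
      show "0 \<le> ?V \<epsilon> x" for x by (simp add: lyapunov_pos less_imp_le)
      show "finite {x. ?V \<epsilon> x \<le> K}" for K using n rates(2) \<epsilon>(1) \<theta> by (rule finite_lyapunov_sublevel)
      show "0 \<le> C \<epsilon>" using C[OF \<epsilon>] by simp
      show "0 < \<epsilon> * (spare_capacity lam mu n / (2 * real CARD('m)))" using \<epsilon> spare by simp
      show "gen (?V \<epsilon>) x \<le> C \<epsilon> - \<epsilon> * (spare_capacity lam mu n / (2 * real CARD('m))) * ?V \<epsilon> x" for x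
        using drift[OF \<epsilon>, of "\<zeta> x" x] policy by (simp add: jump_generator_queue stationary_policy_def o_def)
    qed
    have reach: "0 < pmf (transition P X t x) 0" if "0 < t" for t x
      using queue_descends[where lam = lam and mu = mu and gam = gam and n = n and \<zeta> = \<zeta>, OF n rates(2,3) policy] that by (rule reachable_pos)
    \<comment> \<open>Ergodicity does not mention \<open>\<epsilon>\<close>, so any admissible value
      may supply the Lyapunov function.\<close>
    have "0 < \<epsilon>\<^sub>0 / 2" "\<epsilon>\<^sub>0 / 2 < \<epsilon>\<^sub>0" using \<epsilon>\<^sub>0 by auto
    then obtain \<pi> \<kappa> where "0 < \<kappa>" "\<And>t. 0 \<le> t \<Longrightarrow> bind_pmf \<pi> (transition P X t) = \<pi>"
      "\<And>x. \<exists>M. \<forall>t\<ge>0. \<forall>B. \<bar>measure (transition P X t x) B - measure \<pi> B\<bar> \<le> M * exp (- \<kappa> * t)"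
      using jump_semigroup_drift.exponential_ergodicity[OF sg reach] by metis
    then have "exponentially_ergodic (scaled_space lam mu n)
         (\<lambda>y. P (unscaled lam mu n y)) (\<lambda>t \<omega>. scaled lam mu n (X t \<omega>))"
      by (rule exponentially_ergodic_scaled[OF n mp])
    moreover have "integrable \<pi> (lyapunov mu n \<theta> \<epsilon>)"
      if \<epsilon>: "0 < \<epsilon>" "\<epsilon> < \<epsilon>\<^sub>0" and inv: "invariant_probability (scaled_space lam mu n)
              (\<lambda>y. P (unscaled lam mu n y)) (\<lambda>t \<omega>. scaled lam mu n (X t \<omega>)) \<pi>" for \<epsilon> \<pi>
    proof -
      obtain \<rho> where \<rho>: "\<And>t. 0 \<le> t \<Longrightarrow> bind_pmf \<rho> (transition P X t) = \<rho>"
        and int: "\<And>f :: real ^ 'm \<Rightarrow> real. integrable (measure_pmf \<rho>) (\<lambda>x. f (scaled lam mu n x)) \<Longrightarrow> integrable \<pi> f"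
        using unscaled_invariant_pmf[OF n mp inv] by metis
      interpret drift: jump_semigroup_drift "transition P X" UNIV ?r queue_jump "?V \<epsilon>" "C \<epsilon>"
          "\<epsilon> * (spare_capacity lam mu n / (2 * real CARD('m)))"
        by (rule sg[OF \<epsilon>])
      have "0 \<le> 6 * C \<epsilon> / (\<epsilon> * (spare_capacity lam mu n / (2 * real CARD('m))))"
        using drift.C_nonneg drift.c_pos by (intro divide_nonneg_pos) auto
      from mean_leD(1)[OF drift.V_nonneg this drift.mean_V_invariant[OF \<rho>]] show ?thesis by (rule int)
    qed
    ultimately show ?thesis by blast
  qed
  have generator: "scaled_generator lam mu gam n z (lyapunov mu n \<theta> \<epsilon>) y
      \<le> C \<epsilon> - \<epsilon> * (spare_capacity lam mu n / (2 * real CARD('m))) * lyapunov mu n \<theta> \<epsilon> y"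
    if "0 < \<epsilon>" "\<epsilon> < \<epsilon>\<^sub>0" "y \<in> scaled_space lam mu n" "z \<in> work_conserving n (unscaled lam mu n y)" for \<epsilon> y z
    using that drift[of \<epsilon> z] by (auto simp: scaled_generator_def scaled_space_def unscaled_scaled[OF n])
  show ?thesis
    by (rule exI[of _ \<theta>], rule conjI[OF \<theta>], rule exI[of _ \<epsilon>\<^sub>0], rule conjI[OF \<epsilon>\<^sub>0],
        rule exI[of _ C], intro conjI allI ballI impI) (use ergodic generator C in blast)+
qed

end
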